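(* Let $\mathfrak{X}$ be a homogeneous tree of degree $q+1$ with $q\ge 2$, with boundary $\Omega$, and let $\tau=\frac{2\pi}{\log q}$. Let $f\in L^{2,1}(\mathfrak{X})$. If $z\in\mathbb{R}\setminus(\tau/2)\mathbb{Z}$, then there exists a constant $C_z>0$ (depending only on $z$ and the tree, not on $f$) such that $$\left(\int_{\Omega}|\widetilde{f}(z,\omega)|^2\,d\nu(\omega)\right)^{1/2}\le C_z\,\|f\|_{L^{2,1}(\mathfrak{X})}.$$
   Context: Tree and boundary: $\mathfrak{X}$ is the homogeneous tree of degree $q+1$ ($q\ge2$ an integer), i.e. the connected graph without loops (cycles) in which every vertex has exactly $q+1$ neighbours; $\mathfrak{X}$ is identified with its vertex set, with counting measure and graph distance $d$. Fix a reference vertex $o$ and write $|x|=d(o,x)$. The boundary $\Omega$ is the set of all infinite geodesic rays $\omega=(\omega_0=o,\omega_1,\omega_2,\dots)$ starting at $o$. $\nu$ is the probability measure on $\Omega$ (with the $\sigma$-algebra generated by the sets $E(x)=\{\omega\in\Omega:\omega_{|x|}=x\}$, $x\in\mathfrak X$) invariant under the isometries of $\mathfrak{X}$ fixing $o$; explicitly $\nu(E(x))=\frac{q}{(q+1)q^{|x|}}$ for $|x|\ge1$. Poisson kernel: for $x\in\mathfrak{X}$, $\omega\in\Omega$, let $c(x,\omega)$ be the last vertex lying on $\omega$ in the geodesic path from $o$ to $x$, let $h_\omega(x)=2|c(x,\omega)|-|x|$, and $p(x,\omega)=q^{h_\omega(x)}$. For $z\in\mathbb{C}$, $p^{1/2+iz}(x,\omega)=q^{(1/2+iz)h_\omega(x)}$.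 Helgason-Fourier transform: for finitely supported $f:\mathfrak{X}\to\mathbb{C}$, $$\widetilde f(z,\omega)=\sum_{x\in\mathfrak{X}}f(x)\,p^{1/2+iz}(x,\omega),\qquad z\in\mathbb{C},\ \omega\in\Omega.$$ For general $f\in L^{2,1}(\mathfrak{X})$, $\widetilde f(z,\cdot)$ denotes the continuous extension of this map from the dense subspace of finitely supported functions; thus the statement is that the inequality holds for all finitely supported $f$ and hence, for the extension, for all $f\in L^{2,1}(\mathfrak{X})$. Lorentz norm: for $g:\mathfrak{X}\to\mathbb{C}$, $d_g(s)=\#\{x:|g(x)|>s\}$, $g^*(t)=\inf\{s:d_g(s)\le t\}$, and $\|g\|_{L^{2,1}(\mathfrak{X})}=\frac12\int_0^\infty g^*(t)\,t^{1/2}\,\frac{dt}{t}$; $L^{2,1}(\mathfrak{X})$ is the space of $g$ for which this is finite. *)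

theory Defs
  imports "HOL-Probability.Probability"
begin

text \<open>The vertex set is the whole type \<open>'a\<close>; a graph is its adjacency relation.\<close>

definition graph_cycle :: "('a \<Rightarrow> 'a \<Rightarrow> bool) \<Rightarrow> 'a list \<Rightarrow> bool" where
  "graph_cycle adj xs \<longleftrightarrow>
     3 \<le> length xs \<and> distinct xs \<and> successively adj xs \<and> adj (last xs) (hd xs)"

definition homogeneous_tree :: "('a \<Rightarrow> 'a \<Rightarrow> bool) \<Rightarrow> nat \<Rightarrow> bool" where
  "homogeneous_tree adj q \<longleftrightarrow>
     symp adj \<and> irreflp adj \<and>
     (\<forall>x y. adj\<^sup>*\<^sup>* x y) \<and>
     (\<nexists>xs. graph_cycle adj xs) \<and>
     (\<forall>x. finite {y. adj x y} \<and> card {y. adj x y} = q + 1)"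

definition gdist :: "('a \<Rightarrow> 'a \<Rightarrow> bool) \<Rightarrow> 'a \<Rightarrow> 'a \<Rightarrow> nat" where
  "gdist adj x y = (LEAST n. (adj ^^ n) x y)"

definition geodesic :: "('a \<Rightarrow> 'a \<Rightarrow> bool) \<Rightarrow> 'a \<Rightarrow> 'a \<Rightarrow> 'a list" where
  "geodesic adj x y =
     (THE xs. xs \<noteq> [] \<and> hd xs = x \<and> last xs = y \<and> successively adj xs \<and>
              length xs = gdist adj x y + 1)"

text \<open>In the following, \<open>v0\<close> is the reference vertex, and \<open>gdist adj v0 x\<close> is the length of \<open>x\<close>.\<close>

definition boundary :: "('a \<Rightarrow> 'a \<Rightarrow> bool) \<Rightarrow> 'a \<Rightarrow> (nat \<Rightarrow> 'a) set" where
  "boundary adj v0 =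
     {\<omega>. \<omega> 0 = v0 \<and> (\<forall>m n. m \<le> n \<longrightarrow> gdist adj (\<omega> m) (\<omega> n) = n - m)}"

definition boundary_cyl :: "('a \<Rightarrow> 'a \<Rightarrow> bool) \<Rightarrow> 'a \<Rightarrow> 'a \<Rightarrow> (nat \<Rightarrow> 'a) set" where
  "boundary_cyl adj v0 x = {\<omega> \<in> boundary adj v0. \<omega> (gdist adj v0 x) = x}"

text \<open>
  The conditions below determine the measure uniquely, since the cylinders (together with the
  empty set) form a generator of the \<open>\<sigma>\<close>-algebra that is closed under intersection.
\<close>

definition boundary_measure ::
    "('a \<Rightarrow> 'a \<Rightarrow> bool) \<Rightarrow> nat \<Rightarrow> 'a \<Rightarrow> (nat \<Rightarrow> 'a) measure \<Rightarrow> bool" where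
  "boundary_measure adj q v0 \<nu> \<longleftrightarrow>
     prob_space \<nu> \<and>
     space \<nu> = boundary adj v0 \<and>
     sets \<nu> = sigma_sets (boundary adj v0) (range (boundary_cyl adj v0)) \<and>
     (\<forall>\<phi>. bij \<phi> \<and> (\<forall>x y. gdist adj (\<phi> x) (\<phi> y) = gdist adj x y) \<and> \<phi> v0 = v0 \<longrightarrow>
          distr \<nu> \<nu> (\<lambda>\<omega>. \<phi> \<circ> \<omega>) = \<nu>) \<and>
     (\<forall>x. 1 \<le> gdist adj v0 x \<longrightarrow>
          emeasure \<nu> (boundary_cyl adj v0 x) =
            ennreal (real q / ((real q + 1) * real q ^ gdist adj v0 x)))"

definition confluent :: "('a \<Rightarrow> 'a \<Rightarrow> bool) \<Rightarrow> 'a \<Rightarrow> 'a \<Rightarrow> (nat \<Rightarrow> 'a) \<Rightarrow> 'a" where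
  "confluent adj v0 x \<omega> = last (filter (\<lambda>v. v \<in> range \<omega>) (geodesic adj v0 x))"

definition horo_height :: "('a \<Rightarrow> 'a \<Rightarrow> bool) \<Rightarrow> 'a \<Rightarrow> 'a \<Rightarrow> (nat \<Rightarrow> 'a) \<Rightarrow> int" where
  "horo_height adj v0 x \<omega> =
     2 * int (gdist adj v0 (confluent adj v0 x \<omega>)) - int (gdist adj v0 x)"

text \<open>
  The complex power \<open>p\<^sup>s(x, \<omega>) = q\<^sup>s\<^sup>h\<close> of the Poisson kernel \<open>p(x, \<omega>) = q\<^sup>h\<close>, where
  \<open>h = horo_height adj v0 x \<omega>\<close>.
\<close>

definition poisson_power ::
    "('a \<Rightarrow> 'a \<Rightarrow> bool) \<Rightarrow> nat \<Rightarrow> 'a \<Rightarrow> complex \<Rightarrow> 'a \<Rightarrow> (nat \<Rightarrow> 'a) \<Rightarrow> complex" where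
  "poisson_power adj q v0 s x \<omega> = of_nat q powr (s * of_int (horo_height adj v0 x \<omega>))"

text \<open>Meaningful for finitely supported \<open>f\<close> only.\<close>

definition helgason_fourier ::
    "('a \<Rightarrow> 'a \<Rightarrow> bool) \<Rightarrow> nat \<Rightarrow> 'a \<Rightarrow> complex \<Rightarrow> ('a \<Rightarrow> complex) \<Rightarrow> (nat \<Rightarrow> 'a) \<Rightarrow> complex" where
  "helgason_fourier adj q v0 z f \<omega> =
     (\<Sum>x | f x \<noteq> 0. f x * poisson_power adj q v0 (1/2 + \<i> * z) x \<omega>)"

definition distribution_fun :: "('a \<Rightarrow> complex) \<Rightarrow> real \<Rightarrow> ennreal" where
  "distribution_fun g s = emeasure (count_space UNIV) {x. s < cmod (g x)}"

text \<open>
  The infimum is taken in \<^typ>\<open>ennreal\<close>, so that it is \<open>\<infinity>\<close> over the empty set. On an infinite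
  vertex set the restriction to \<open>0 \<le> s\<close> is no loss, as every \<open>s < 0\<close> has infinite
  distribution function.
\<close>

definition decreasing_rearrangement :: "('a \<Rightarrow> complex) \<Rightarrow> real \<Rightarrow> ennreal" where
  "decreasing_rearrangement g t =
     Inf {ennreal s | s. 0 \<le> s \<and> distribution_fun g s \<le> ennreal t}"

definition lorentz21_norm :: "('a \<Rightarrow> complex) \<Rightarrow> ennreal" where
  "lorentz21_norm g =
     ennreal (1/2) *
     (\<integral>\<^sup>+ t \<in> {0<..}. decreasing_rearrangement g t * ennreal (t powr (1/2) / t) \<partial>lborel)"

definition lorentz21 :: "('a \<Rightarrow> complex) set" where
  "lorentz21 = {g. lorentz21_norm g < \<infinity>}"

definition L2_space :: "'b measure \<Rightarrow> ('b \<Rightarrow> complex) set" where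
  "L2_space M = {F \<in> borel_measurable M. integrable M (\<lambda>\<omega>. (cmod (F \<omega>))\<^sup>2)}"

text \<open>Meaningful for elements of \<^const>\<open>L2_space\<close> only.\<close>

definition L2_norm :: "'b measure \<Rightarrow> ('b \<Rightarrow> complex) \<Rightarrow> real" where
  "L2_norm M F = sqrt (\<integral>\<omega>. (cmod (F \<omega>))\<^sup>2 \<partial>M)"

text \<open>
  \<open>T\<close> is a continuous map from the Lorentz space to \<open>L\<^sup>2(\<nu>)\<close> (whose elements are represented
  by functions, hence the almost-everywhere equality) that extends the transform at \<open>z\<close>
  from the finitely supported functions.
\<close>

definition helgason_fourier_extension ::
    "('a \<Rightarrow> 'a \<Rightarrow> bool) \<Rightarrow> nat \<Rightarrow> 'a \<Rightarrow> (nat \<Rightarrow> 'a) measure \<Rightarrow> complex \<Rightarrow>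
     (('a \<Rightarrow> complex) \<Rightarrow> (nat \<Rightarrow> 'a) \<Rightarrow> complex) \<Rightarrow> bool" where
  "helgason_fourier_extension adj q v0 \<nu> z T \<longleftrightarrow>
     (\<forall>f \<in> lorentz21. T f \<in> L2_space \<nu>) \<and>
     (\<forall>f. finite {x. f x \<noteq> 0} \<longrightarrow>
          (AE \<omega> in \<nu>. T f \<omega> = helgason_fourier adj q v0 z f \<omega>)) \<and>
     (\<forall>f \<in> lorentz21. \<forall>g. (\<forall>n. g n \<in> lorentz21) \<longrightarrow>
          (\<lambda>n. lorentz21_norm (\<lambda>x. g n x - f x)) \<longlonglongrightarrow> 0 \<longrightarrow>
          (\<lambda>n. L2_norm \<nu> (\<lambda>\<omega>. T (g n) \<omega> - T f \<omega>)) \<longlonglongrightarrow> 0)"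

end

theory Submission
  imports Defs
begin

text \<open>
  Fix \<open>z\<close> and put \<open>s = 1/2 + \<i> z\<close> and \<open>w = q powr (2 \<i> z)\<close>, a number of modulus one which the
  hypothesis on \<open>z\<close> makes different from \<open>1\<close>. For a vertex \<open>x\<close> of level \<open>n\<close> let \<open>e\<^sub>x\<close> be the indicator
  of the cylinder of \<open>x\<close> divided by its measure (\<open>ncyl\<close>), and let \<open>x\<^sub>0, \<dots>, x\<^sub>n\<close> be the geodesic from
  the root to \<open>x\<close>. The Poisson power is \<open>q powr (- s n)\<close> times a constant plus a multiple of the sum of
  the terms \<open>w ^ k e\<^bsub>x\<^sub>k\<^esub>\<close>. Now \<open>e\<^bsub>x\<^sub>k\<^esub>\<close> is the conditional expectation of \<open>e\<^sub>x\<close> given the first \<open>k\<close>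
  vertices of the ray. Since \<open>w \<noteq> 1\<close>, summation by parts turns the sum into a combination of
  \<open>1\<close>, \<open>w ^ n e\<^sub>x\<close> and \<open>U e\<^sub>x\<close>, where \<open>U\<close> multiplies the \<open>k\<close>-th martingale difference by \<open>w ^ k\<close>
  (\<open>poisson_power_expansion\<close>). As martingale differences of different levels are orthogonal, \<open>U\<close> is an isometry
  (\<open>rotated_isometry\<close>): this is where the oscillation enters. A bound of the Poisson power by absolute
  values alone would lose a logarithm, as one sees for \<open>w = 1\<close> on the indicators of balls.

  After this step absolute values are harmless. It remains to bound in \<open>L\<^sup>2\<close> the sum of
  \<open>\<bar>f x\<bar> q powr (- n/2) e\<^sub>x\<close>. If \<open>\<bar>f\<bar>\<close> is the indicator of a finite set \<open>E\<close>, then at a given ray the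
  summands grow geometrically with the level, so that the sum is comparable to its last term and the
  square of the sum to the sum of the squares. Each square has integral of order \<open>1\<close>, whence the norm is
  of order \<open>sqrt (card E)\<close> (\<open>L2_norm_sum_wcyl_le\<close>). Slicing a general \<open>\<bar>f\<bar>\<close> into superlevel sets
  yields the integral of the square root of the distribution function
  (\<open>L2_norm_weighted_wcyl_le\<close>), which is at most the Lorentz norm
  (\<open>layer_cake_le_lorentz21_norm\<close>).

  The passage to all of \<open>L\<^bsup>2,1\<^esup>\<close> uses that truncations to balls converge in the Lorentz norm
  (\<open>lorentz21_tail\<close>) and that \<open>L\<^sup>2\<close> is complete (\<open>L2_complete\<close>).
\<close>

section \<open>Square-integrable functions\<close>

lemma L2_spaceD [measurable_dest]: "F \<in> L2_space M \<Longrightarrow> F \<in> borel_measurable M"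
  by (simp add: L2_space_def)

lemma L2_space_integrable_norm: "F \<in> L2_space M \<Longrightarrow> integrable M (\<lambda>\<omega>. (cmod (F \<omega>))\<^sup>2)"
  by (simp add: L2_space_def)

lemma L2_norm_nonneg [simp]: "0 \<le> L2_norm M F"
  by (simp add: L2_norm_def)

lemma L2_norm_squared: "(L2_norm M F)\<^sup>2 = (\<integral>\<omega>. (cmod (F \<omega>))\<^sup>2 \<partial>M)"
  by (simp add: L2_norm_def)

lemma L2_norm_cong: "(\<And>\<omega>. \<omega> \<in> space M \<Longrightarrow> F \<omega> = G \<omega>) \<Longrightarrow> L2_norm M F = L2_norm M G"
  unfolding L2_norm_def by (metis (mono_tags, lifting) Bochner_Integration.integral_cong)

lemma L2_space_cong:
  "(\<And>\<omega>. \<omega> \<in> space M \<Longrightarrow> F \<omega> = G \<omega>) \<Longrightarrow> F \<in> L2_space M \<longleftrightarrow> G \<in> L2_space M"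
  unfolding L2_space_def mem_Collect_eq
  by (intro conj_cong measurable_cong Bochner_Integration.integrable_cong) auto

lemma nn_integral_L2_norm:
  "F \<in> L2_space M \<Longrightarrow> (\<integral>\<^sup>+\<omega>. ennreal ((cmod (F \<omega>))\<^sup>2) \<partial>M) = ennreal ((L2_norm M F)\<^sup>2)"
  unfolding L2_norm_squared
  by (intro nn_integral_eq_integral L2_space_integrable_norm) auto

lemma L2_space_scale:
  assumes "F \<in> L2_space M" shows "(\<lambda>\<omega>. c * F \<omega>) \<in> L2_space M"
  using assms unfolding L2_space_def by (auto simp: norm_mult power_mult_distrib)

lemma L2_norm_scale: "L2_norm M (\<lambda>\<omega>. c * F \<omega>) = cmod c * L2_norm M F"
  unfolding L2_norm_def by (simp add: norm_mult power_mult_distrib real_sqrt_mult)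

lemma L2_space_bound:
  assumes "F \<in> borel_measurable M" "G \<in> L2_space M" "\<And>\<omega>. cmod (F \<omega>) \<le> cmod (G \<omega>)"
  shows "F \<in> L2_space M" "L2_norm M F \<le> L2_norm M G"
proof -
  note [measurable] = assms(1)
  have le: "(cmod (F \<omega>))\<^sup>2 \<le> (cmod (G \<omega>))\<^sup>2" for \<omega>
    using assms(3) by (intro power_mono) auto
  have int: "integrable M (\<lambda>\<omega>. (cmod (F \<omega>))\<^sup>2)"
    by (rule Bochner_Integration.integrable_bound[OF L2_space_integrable_norm[OF assms(2)]])
       (use le in auto)
  then show "F \<in> L2_space M"
    using assms(1) by (simp add: L2_space_def)
  show "L2_norm M F \<le> L2_norm M G"
    unfolding L2_norm_def
    by (intro real_sqrt_le_mono integral_mono int L2_space_integrable_norm assms le)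
qed

lemma L2_space_integrable_mult:
  assumes F: "F \<in> L2_space M" and G: "G \<in> L2_space M"
  shows "integrable M (\<lambda>\<omega>. F \<omega> * cnj (G \<omega>))" "integrable M (\<lambda>\<omega>. cmod (F \<omega>) * cmod (G \<omega>))"
proof -
  note [measurable] = L2_spaceD[OF F] L2_spaceD[OF G]
  have [measurable]: "(\<lambda>\<omega>. cnj (G \<omega>)) \<in> borel_measurable M"
    by (rule borel_measurable_continuous_on[OF _ L2_spaceD[OF G]]) (intro continuous_intros)
  have *: "integrable M (\<lambda>\<omega>. (cmod (F \<omega>))\<^sup>2 + (cmod (G \<omega>))\<^sup>2)"
    by (intro Bochner_Integration.integrable_add L2_space_integrable_norm F G)
  have le: "cmod (F \<omega>) * cmod (G \<omega>) \<le> (cmod (F \<omega>))\<^sup>2 + (cmod (G \<omega>))\<^sup>2" for \<omega>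
    using sum_squares_bound[of "cmod (F \<omega>)" "cmod (G \<omega>)"]
      mult_nonneg_nonneg[of "cmod (F \<omega>)" "cmod (G \<omega>)"] by (simp del: mult_nonneg_nonneg)
  show "integrable M (\<lambda>\<omega>. F \<omega> * cnj (G \<omega>))"
    by (rule Bochner_Integration.integrable_bound[OF *]) (use le in \<open>auto simp: norm_mult\<close>)
  show "integrable M (\<lambda>\<omega>. cmod (F \<omega>) * cmod (G \<omega>))"
    by (rule Bochner_Integration.integrable_bound[OF *]) (use le in \<open>auto simp: abs_mult\<close>)
qed

lemma L2_Cauchy_Schwarz:
  assumes F: "F \<in> L2_space M" and G: "G \<in> L2_space M"
  shows "(\<integral>\<omega>. cmod (F \<omega>) * cmod (G \<omega>) \<partial>M) \<le> L2_norm M F * L2_norm M G"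
proof -
  note [measurable] = L2_spaceD[OF F] L2_spaceD[OF G]
  let ?I = "\<integral>\<omega>. cmod (F \<omega>) * cmod (G \<omega>) \<partial>M"
  have I: "0 \<le> ?I"
    by (intro Bochner_Integration.integral_nonneg) auto
  have "ennreal (?I\<^sup>2) = (\<integral>\<^sup>+\<omega>. ennreal (cmod (F \<omega>)) * ennreal (cmod (G \<omega>)) \<partial>M)\<^sup>2"
    using nn_integral_eq_integral[OF L2_space_integrable_mult(2)[OF F G]] I
    by (simp add: ennreal_mult ennreal_power)
  also have "\<dots> \<le> (\<integral>\<^sup>+\<omega>. ennreal (cmod (F \<omega>)) ^ 2 \<partial>M) * (\<integral>\<^sup>+\<omega>. ennreal (cmod (G \<omega>)) ^ 2 \<partial>M)"
    by (intro Cauchy_Schwarz_nn_integral) auto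
  also have "\<dots> = ennreal ((L2_norm M F * L2_norm M G)\<^sup>2)"
    using nn_integral_L2_norm[OF F] nn_integral_L2_norm[OF G]
    by (simp add: ennreal_power ennreal_mult power_mult_distrib)
  finally have "?I\<^sup>2 \<le> (L2_norm M F * L2_norm M G)\<^sup>2"
    by simp
  then show ?thesis
    by (rule power2_le_imp_le) simp
qed

lemma L2_space_add:
  assumes F: "F \<in> L2_space M" and G: "G \<in> L2_space M"
  shows "(\<lambda>\<omega>. F \<omega> + G \<omega>) \<in> L2_space M"
    and L2_norm_triangle: "L2_norm M (\<lambda>\<omega>. F \<omega> + G \<omega>) \<le> L2_norm M F + L2_norm M G"
proof -
  note [measurable] = L2_spaceD[OF F] L2_spaceD[OF G]
  let ?B = "\<lambda>\<omega>. (cmod (F \<omega>))\<^sup>2 + 2 * (cmod (F \<omega>) * cmod (G \<omega>)) + (cmod (G \<omega>))\<^sup>2"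
  have B: "integrable M ?B"
    by (intro Bochner_Integration.integrable_add integrable_mult_right
        L2_space_integrable_norm L2_space_integrable_mult F G)
  have le: "(cmod (F \<omega> + G \<omega>))\<^sup>2 \<le> ?B \<omega>" for \<omega>
  proof -
    have "(cmod (F \<omega> + G \<omega>))\<^sup>2 \<le> (cmod (F \<omega>) + cmod (G \<omega>))\<^sup>2"
      by (intro power_mono norm_triangle_ineq) auto
    then show ?thesis
      by (simp add: power2_sum)
  qed
  have int: "integrable M (\<lambda>\<omega>. (cmod (F \<omega> + G \<omega>))\<^sup>2)"
    by (rule Bochner_Integration.integrable_bound[OF B])
       (use le in \<open>auto intro: order_trans[OF _ abs_ge_self]\<close>)
  then show "(\<lambda>\<omega>. F \<omega> + G \<omega>) \<in> L2_space M"
    by (simp add: L2_space_def)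
  have "(L2_norm M (\<lambda>\<omega>. F \<omega> + G \<omega>))\<^sup>2 \<le> (\<integral>\<omega>. ?B \<omega> \<partial>M)"
    unfolding L2_norm_squared by (intro integral_mono int B le)
  also have "\<dots> = (L2_norm M F)\<^sup>2 + 2 * (\<integral>\<omega>. cmod (F \<omega>) * cmod (G \<omega>) \<partial>M) + (L2_norm M G)\<^sup>2"
    using L2_space_integrable_norm[OF F] L2_space_integrable_norm[OF G]
      L2_space_integrable_mult(2)[OF F G]
    by (simp add: L2_norm_squared)
  also have "\<dots> \<le> (L2_norm M F + L2_norm M G)\<^sup>2"
    using L2_Cauchy_Schwarz[OF F G] by (simp add: power2_sum)
  finally show "L2_norm M (\<lambda>\<omega>. F \<omega> + G \<omega>) \<le> L2_norm M F + L2_norm M G"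
    by (rule power2_le_imp_le) simp
qed

lemma L2_space_diff:
  assumes F: "F \<in> L2_space M" and G: "G \<in> L2_space M"
  shows "(\<lambda>\<omega>. F \<omega> - G \<omega>) \<in> L2_space M"
  using L2_space_add(1)[OF F L2_space_scale[OF G, of "-1"]] by simp

lemma L2_norm_triangle_diff:
  assumes "F \<in> L2_space M" "G \<in> L2_space M" "H \<in> L2_space M"
  shows "L2_norm M (\<lambda>\<omega>. F \<omega> - H \<omega>)
    \<le> L2_norm M (\<lambda>\<omega>. F \<omega> - G \<omega>) + L2_norm M (\<lambda>\<omega>. G \<omega> - H \<omega>)"
  using L2_norm_triangle[OF L2_space_diff[OF assms(1,2)] L2_space_diff[OF assms(2,3)]] by simp

lemma L2_norm_minus_commute:
  "L2_norm M (\<lambda>\<omega>. F \<omega> - G \<omega>) = L2_norm M (\<lambda>\<omega>. G \<omega> - F \<omega>)"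
  unfolding L2_norm_def by (simp add: norm_minus_commute)

lemma L2_space_sum:
  "(\<And>i. i \<in> I \<Longrightarrow> F i \<in> L2_space M) \<Longrightarrow> (\<lambda>\<omega>. \<Sum>i\<in>I. F i \<omega>) \<in> L2_space M"
proof (induction I rule: infinite_finite_induct)
  case (insert i I)
  then show ?case
    using L2_space_add(1)[of "F i" M "\<lambda>\<omega>. \<Sum>i\<in>I. F i \<omega>"] by simp
qed (simp_all add: L2_space_def)

lemma L2_norm_cong_AE:
  assumes "F \<in> borel_measurable M" "G \<in> borel_measurable M" "AE \<omega> in M. F \<omega> = G \<omega>"
  shows "L2_norm M F = L2_norm M G"
  unfolding L2_norm_def
  using assms by (intro arg_cong[where f=sqrt] integral_cong_AE) auto

lemma L2_norm_eq_0_AE: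
  assumes "F \<in> L2_space M" "L2_norm M F = 0"
  shows "AE \<omega> in M. F \<omega> = 0"
proof -
  have "(\<integral>\<^sup>+\<omega>. ennreal ((cmod (F \<omega>))\<^sup>2) \<partial>M) = 0"
    using nn_integral_L2_norm[OF assms(1)] assms(2) by simp
  then have "AE \<omega> in M. ennreal ((cmod (F \<omega>))\<^sup>2) = 0"
    using assms(1) by (subst (asm) nn_integral_0_iff_AE) (auto simp: L2_space_def)
  then show ?thesis
    by eventually_elim (simp add: ennreal_eq_0_iff)
qed

text \<open>
  The coefficients enter through their moduli only. Replacing all of them by other numbers of
  modulus one therefore preserves the norm, which is what makes the multiplier \<open>rotated\<close> below an
  isometry.
\<close>

lemma L2_norm_orthogonal_sum:
  assumes "finite K" "\<And>k. k \<in> K \<Longrightarrow> D k \<in> L2_space M"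
    and "\<And>j k. j \<in> K \<Longrightarrow> k \<in> K \<Longrightarrow> j \<noteq> k \<Longrightarrow> (\<integral>\<omega>. D j \<omega> * cnj (D k \<omega>) \<partial>M) = 0"
  shows "(L2_norm M (\<lambda>\<omega>. \<Sum>k\<in>K. c k * D k \<omega>))\<^sup>2 = (\<Sum>k\<in>K. (cmod (c k) * L2_norm M (D k))\<^sup>2)"
proof -
  have int: "integrable M (\<lambda>\<omega>. c j * cnj (c k) * (D j \<omega> * cnj (D k \<omega>)))" if "j \<in> K" "k \<in> K" for j k
    using L2_space_integrable_mult(1) assms(2) that by (intro integrable_mult_right) auto
  have "complex_of_real ((L2_norm M (\<lambda>\<omega>. \<Sum>k\<in>K. c k * D k \<omega>))\<^sup>2)
      = (\<integral>\<omega>. complex_of_real ((cmod (\<Sum>k\<in>K. c k * D k \<omega>))\<^sup>2) \<partial>M)"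
    unfolding L2_norm_squared by (rule integral_complex_of_real[symmetric])
  also have "\<dots> = (\<integral>\<omega>. (\<Sum>j\<in>K. \<Sum>k\<in>K. c j * cnj (c k) * (D j \<omega> * cnj (D k \<omega>))) \<partial>M)"
    unfolding complex_norm_square
    by (intro Bochner_Integration.integral_cong refl)
       (simp add: sum_product mult_ac)
  also have "\<dots> = (\<Sum>j\<in>K. \<Sum>k\<in>K. c j * cnj (c k) * (\<integral>\<omega>. D j \<omega> * cnj (D k \<omega>) \<partial>M))"
    using int by (simp add: Bochner_Integration.integral_sum)
  also have "\<dots> = (\<Sum>j\<in>K. \<Sum>k\<in>K. if j = k then complex_of_real ((cmod (c j) * L2_norm M (D j))\<^sup>2) else 0)"
  proof (intro sum.cong refl)
    fix j k
    assume "j \<in> K" "k \<in> K"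
    have "(\<integral>\<omega>. D j \<omega> * cnj (D j \<omega>) \<partial>M) = complex_of_real ((L2_norm M (D j))\<^sup>2)"
      unfolding L2_norm_squared integral_complex_of_real[symmetric] complex_norm_square ..
    then show "c j * cnj (c k) * (\<integral>\<omega>. D j \<omega> * cnj (D k \<omega>) \<partial>M) =
        (if j = k then complex_of_real ((cmod (c j) * L2_norm M (D j))\<^sup>2) else 0)"
      using assms(3)[OF \<open>j \<in> K\<close> \<open>k \<in> K\<close>]
      by (auto simp: power_mult_distrib complex_norm_square[symmetric])
  qed
  also have "\<dots> = complex_of_real (\<Sum>k\<in>K. (cmod (c k) * L2_norm M (D k))\<^sup>2)"
    using assms(1) by simp
  finally show ?thesis
    by (simp only: of_real_eq_iff)
qed

text \<open>
  The argument of Riesz and Fischer: a rapidly convergent subsequence converges almost everywhere,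
  and Fatou's lemma bounds the distance from each \<open>F n\<close> to its limit.
\<close>

lemma L2_complete:
  assumes F: "\<And>n. F n \<in> L2_space M"
    and Cauchy: "\<And>e. 0 < e \<Longrightarrow> \<exists>N. \<forall>m\<ge>N. \<forall>n\<ge>N. L2_norm M (\<lambda>\<omega>. F m \<omega> - F n \<omega>) \<le> e"
  shows "\<exists>G\<in>L2_space M. (\<lambda>n. L2_norm M (\<lambda>\<omega>. G \<omega> - F n \<omega>)) \<longlonglongrightarrow> 0"
proof -
  have [measurable]: "F n \<in> borel_measurable M" for n
    using F by (rule L2_spaceD)
  have "\<exists>N. \<forall>m\<ge>N. \<forall>n\<ge>N. L2_norm M (\<lambda>\<omega>. F m \<omega> - F n \<omega>) \<le> (1/4) ^ k" for k
    by (rule Cauchy) simp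
  then obtain N where N: "\<And>k m n. N k \<le> m \<Longrightarrow> N k \<le> n \<Longrightarrow>
      L2_norm M (\<lambda>\<omega>. F m \<omega> - F n \<omega>) \<le> (1/4) ^ k"
    by metis
  define r where "r k = k + (\<Sum>j\<le>k. N j)" for k
  have r: "N k \<le> r k" "r k \<le> r (Suc k)" "k \<le> r k" for k
    using member_le_sum[of k "{..k}" N] by (auto simp: r_def)
  define h where "h k \<omega> = F (r (Suc k)) \<omega> - F (r k) \<omega>" for k \<omega>
  have h: "h k \<in> L2_space M" for k
    unfolding h_def by (intro L2_space_diff F)
  have [measurable]: "h k \<in> borel_measurable M" for k
    using h by (rule L2_spaceD)
  have h_le: "L2_norm M (h k) \<le> (1/4) ^ k" for k
    unfolding h_def using r(1)[of k] r(2)[of k] by (intro N) auto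
  \<comment> \<open>The weights \<open>4 ^ k\<close> turn the finiteness of this sum at \<open>\<omega>\<close> into geometric decay of \<open>h k \<omega>\<close>;
     they are affordable because the squared norms of \<open>h k\<close> are at most \<open>16 ^ - k\<close>.\<close>
  have "(\<integral>\<^sup>+\<omega>. (\<Sum>k. ennreal (4 ^ k * (cmod (h k \<omega>))\<^sup>2)) \<partial>M)
      = (\<Sum>k. ennreal (4 ^ k * (L2_norm M (h k))\<^sup>2))"
    by (subst nn_integral_suminf, simp)
       (simp add: ennreal_mult nn_integral_cmult nn_integral_L2_norm[OF h])
  also have "\<dots> \<le> (\<Sum>k. ennreal ((1/4) ^ k))"
  proof (intro suminf_le ennreal_leI)
    fix k
    have "4 ^ k * (L2_norm M (h k))\<^sup>2 \<le> 4 ^ k * ((1/4) ^ k)\<^sup>2"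
      by (intro mult_left_mono power_mono h_le) auto
    also have "\<dots> = (1/4 :: real) ^ k"
      by (simp add: power2_eq_square flip: power_mult_distrib)
    finally show "4 ^ k * (L2_norm M (h k))\<^sup>2 \<le> (1/4) ^ k" .
  qed auto
  also have "\<dots> < \<infinity>"
    by (subst suminf_ennreal2) (auto simp: summable_geometric_iff)
  finally have "(\<integral>\<^sup>+\<omega>. (\<Sum>k. ennreal (4 ^ k * (cmod (h k \<omega>))\<^sup>2)) \<partial>M) \<noteq> \<infinity>"
    by simp
  then have "AE \<omega> in M. (\<Sum>k. ennreal (4 ^ k * (cmod (h k \<omega>))\<^sup>2)) \<noteq> \<infinity>"
    by (intro nn_integral_PInf_AE) auto
  moreover have "convergent (\<lambda>k. F (r k) \<omega>)"
    if "(\<Sum>k. ennreal (4 ^ k * (cmod (h k \<omega>))\<^sup>2)) \<noteq> \<infinity>" for \<omega>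
  proof -
    define S where "S = (\<Sum>k. ennreal (4 ^ k * (cmod (h k \<omega>))\<^sup>2))"
    have "S \<noteq> \<infinity>"
      unfolding S_def by (rule that)
    then obtain B where B: "0 \<le> B" "S = ennreal B"
      by (cases S) auto
    have "cmod (h k \<omega>) \<le> sqrt B * (1/2) ^ k" for k
    proof -
      have "ennreal (4 ^ k * (cmod (h k \<omega>))\<^sup>2) \<le> ennreal B"
        unfolding B(2)[symmetric] S_def
        using sum_le_suminf[OF summableI, of "{k}" "\<lambda>k. ennreal (4 ^ k * (cmod (h k \<omega>))\<^sup>2)"]
        by (simp only: finite.intros sum.insert sum.empty empty_iff not_False_eq_True add_0_right
            zero_le simp_thms)
      then have "4 ^ k * (cmod (h k \<omega>))\<^sup>2 \<le> B"
        using B(1) by simp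
      moreover have "(4::real) ^ k = (2 ^ k)\<^sup>2"
        by (simp add: power2_eq_square flip: power_mult_distrib)
      ultimately have "(2 ^ k * cmod (h k \<omega>))\<^sup>2 \<le> B"
        by (simp add: power_mult_distrib)
      then have "2 ^ k * cmod (h k \<omega>) \<le> sqrt B"
        by (rule real_le_rsqrt)
      then show ?thesis
        by (simp add: field_simps)
    qed
    moreover have "summable (\<lambda>k. sqrt B * (1/2) ^ k)"
      by (rule summable_mult, rule summable_geometric) simp
    ultimately have "summable (\<lambda>k. h k \<omega>)"
      by (intro summable_comparison_test[of "\<lambda>k. h k \<omega>" "\<lambda>k. sqrt B * (1/2) ^ k"]) blast
    then have "(\<lambda>n. \<Sum>k<n. h k \<omega>) \<longlonglongrightarrow> (\<Sum>k. h k \<omega>)"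
      by (rule summable_LIMSEQ)
    moreover have "(\<Sum>k<n. h k \<omega>) = F (r n) \<omega> - F (r 0) \<omega>" for n
      unfolding h_def by (rule sum_lessThan_telescope)
    ultimately have "(\<lambda>n. F (r n) \<omega> - F (r 0) \<omega> + F (r 0) \<omega>) \<longlonglongrightarrow> (\<Sum>k. h k \<omega>) + F (r 0) \<omega>"
      by (intro tendsto_add tendsto_const) simp
    then show "convergent (\<lambda>k. F (r k) \<omega>)"
      by (auto simp: convergent_def)
  qed
  ultimately have conv: "AE \<omega> in M. convergent (\<lambda>k. F (r k) \<omega>)"
    by (rule eventually_mono)
  define G where "G \<omega> = lim (\<lambda>k. F (r k) \<omega>)" for \<omega>
  have [measurable]: "G \<in> borel_measurable M"
    unfolding G_def by (intro borel_measurable_lim_metric) auto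
  have lim: "AE \<omega> in M. (\<lambda>k. F (r k) \<omega>) \<longlonglongrightarrow> G \<omega>"
    unfolding G_def by (rule eventually_mono[OF conv]) (simp add: convergent_LIMSEQ_iff)
  have fatou: "(\<integral>\<^sup>+\<omega>. ennreal ((cmod (G \<omega> - F n \<omega>))\<^sup>2) \<partial>M) \<le> ennreal (e\<^sup>2)"
    if e: "0 < e" and n: "n \<ge> N" and N: "\<forall>m\<ge>N. \<forall>n\<ge>N. L2_norm M (\<lambda>\<omega>. F m \<omega> - F n \<omega>) \<le> e" for e n N
  proof -
    have "(\<integral>\<^sup>+\<omega>. ennreal ((cmod (G \<omega> - F n \<omega>))\<^sup>2) \<partial>M)
        = (\<integral>\<^sup>+\<omega>. liminf (\<lambda>k. ennreal ((cmod (F (r k) \<omega> - F n \<omega>))\<^sup>2)) \<partial>M)"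
    proof (rule nn_integral_cong_AE, rule eventually_mono[OF lim])
      fix \<omega>
      assume "(\<lambda>k. F (r k) \<omega>) \<longlonglongrightarrow> G \<omega>"
      then have "(\<lambda>k. ennreal ((cmod (F (r k) \<omega> - F n \<omega>))\<^sup>2)) \<longlonglongrightarrow> ennreal ((cmod (G \<omega> - F n \<omega>))\<^sup>2)"
        by (intro tendsto_ennrealI tendsto_intros)
      then show "ennreal ((cmod (G \<omega> - F n \<omega>))\<^sup>2) = liminf (\<lambda>k. ennreal ((cmod (F (r k) \<omega> - F n \<omega>))\<^sup>2))"
        by (intro lim_imp_Liminf[symmetric]) auto
    qed
    also have "\<dots> \<le> liminf (\<lambda>k. \<integral>\<^sup>+\<omega>. ennreal ((cmod (F (r k) \<omega> - F n \<omega>))\<^sup>2) \<partial>M)"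
      by (intro nn_integral_liminf) auto
    also have "\<dots> \<le> ennreal (e\<^sup>2)"
    proof (rule Liminf_le)
      show "\<forall>\<^sub>F k in sequentially. (\<integral>\<^sup>+\<omega>. ennreal ((cmod (F (r k) \<omega> - F n \<omega>))\<^sup>2) \<partial>M) \<le> ennreal (e\<^sup>2)"
      proof (rule eventually_sequentiallyI)
        fix k assume "k \<ge> N"
        then have "L2_norm M (\<lambda>\<omega>. F (r k) \<omega> - F n \<omega>) \<le> e"
          using N n r(3)[of k] by auto
        then show "(\<integral>\<^sup>+\<omega>. ennreal ((cmod (F (r k) \<omega> - F n \<omega>))\<^sup>2) \<partial>M) \<le> ennreal (e\<^sup>2)"
          by (subst nn_integral_L2_norm) (auto intro!: L2_space_diff F power_mono)
      qed
    qed auto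
    finally show ?thesis .
  qed
  have GF: "(\<lambda>\<omega>. G \<omega> - F n \<omega>) \<in> L2_space M \<and> L2_norm M (\<lambda>\<omega>. G \<omega> - F n \<omega>) \<le> e"
    if e: "0 < e" and n: "n \<ge> N" and N: "\<forall>m\<ge>N. \<forall>n\<ge>N. L2_norm M (\<lambda>\<omega>. F m \<omega> - F n \<omega>) \<le> e" for e n N
  proof
    have "(\<integral>\<^sup>+\<omega>. ennreal ((cmod (G \<omega> - F n \<omega>))\<^sup>2) \<partial>M) < \<infinity>"
      using le_less_trans[OF fatou[OF that] ennreal_less_top] by simp
    then show *: "(\<lambda>\<omega>. G \<omega> - F n \<omega>) \<in> L2_space M"
      unfolding L2_space_def by (auto intro!: integrableI_bounded)
    have "(L2_norm M (\<lambda>\<omega>. G \<omega> - F n \<omega>))\<^sup>2 \<le> e\<^sup>2"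
      using fatou[OF that] unfolding nn_integral_L2_norm[OF *] by simp
    then show "L2_norm M (\<lambda>\<omega>. G \<omega> - F n \<omega>) \<le> e"
      by (rule power2_le_imp_le) (use e in simp)
  qed
  obtain N1 where N1: "\<forall>m\<ge>N1. \<forall>n\<ge>N1. L2_norm M (\<lambda>\<omega>. F m \<omega> - F n \<omega>) \<le> 1"
    using Cauchy[of 1] by auto
  have "G \<in> L2_space M"
    using L2_space_add(1)[OF conjunct1[OF GF[OF _ order_refl N1]] F[of N1]] by simp
  moreover have "(\<lambda>n. L2_norm M (\<lambda>\<omega>. G \<omega> - F n \<omega>)) \<longlonglongrightarrow> 0"
  proof (rule LIMSEQ_I)
    fix e :: real
    assume "0 < e"
    then obtain N where "\<forall>m\<ge>N. \<forall>n\<ge>N. L2_norm M (\<lambda>\<omega>. F m \<omega> - F n \<omega>) \<le> e / 2"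
      using Cauchy[of "e/2"] by auto
    then show "\<exists>N. \<forall>n\<ge>N. norm (L2_norm M (\<lambda>\<omega>. G \<omega> - F n \<omega>) - 0) < e"
      using GF[of "e/2" N] \<open>0 < e\<close> by (intro exI[of _ N]) force
  qed
  ultimately show ?thesis
    by blast
qed

section \<open>The Lorentz norm\<close>

lemma distribution_fun_mono:
  assumes "\<And>x. cmod (f x) \<le> cmod (g x)"
  shows "distribution_fun f s \<le> distribution_fun g s"
  unfolding distribution_fun_def by (intro emeasure_mono) (auto intro: less_le_trans assms)

lemma distribution_fun_antimono: "s \<le> s' \<Longrightarrow> distribution_fun f s' \<le> distribution_fun f s"
  unfolding distribution_fun_def by (intro emeasure_mono) auto

lemma distribution_fun_finite:
  assumes "finite {x. s < cmod (f x)}"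
  shows "distribution_fun f s = ennreal (card {x. s < cmod (f x)})"
  unfolding distribution_fun_def using assms
  by (simp add: emeasure_count_space ennreal_of_nat_eq_real_of_nat)

lemma rearrangement_le:
  "0 \<le> s \<Longrightarrow> distribution_fun f s \<le> ennreal t \<Longrightarrow> decreasing_rearrangement f t \<le> ennreal s"
  unfolding decreasing_rearrangement_def by (intro Inf_lower) auto

lemma rearrangement_mono:
  assumes "\<And>x. cmod (f x) \<le> cmod (g x)"
  shows "decreasing_rearrangement f t \<le> decreasing_rearrangement g t"
  unfolding decreasing_rearrangement_def
  using distribution_fun_mono[of f g, OF assms]
  by (intro Inf_superset_mono Collect_mono) (blast intro: order_trans)

lemma rearrangement_antimono:
  "t \<le> t' \<Longrightarrow> decreasing_rearrangement f t' \<le> decreasing_rearrangement f t"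
  unfolding decreasing_rearrangement_def
  by (intro Inf_superset_mono Collect_mono) (blast intro: order_trans ennreal_leI)

lemma rearrangement_measurable [measurable]: "decreasing_rearrangement f \<in> borel_measurable borel"
proof (rule borel_measurableI_greater)
  fix y
  let ?A = "{t. y < decreasing_rearrangement f t}"
  have "is_interval ?A"
    unfolding is_interval_1 using rearrangement_antimono[of _ _ f]
    by (auto intro: less_le_trans)
  then have "?A \<in> sets borel"
    by (rule real_interval_borel_measurable)
  then show "{t \<in> space borel. y < decreasing_rearrangement f t} \<in> sets borel"
    by simp
qed

lemma lorentz21_norm_mono:
  assumes "\<And>x. cmod (f x) \<le> cmod (g x)"
  shows "lorentz21_norm f \<le> lorentz21_norm g"
  unfolding lorentz21_norm_def
  by (intro mult_left_mono nn_integral_mono mult_right_mono rearrangement_mono assms) auto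

lemma nn_integral_half_power:
  assumes "0 \<le> c"
  shows "(\<integral>\<^sup>+t. ennreal (t powr (1/2) / t) * indicator {0<..c} t \<partial>lborel) = ennreal (2 * sqrt c)"
proof -
  have "((\<lambda>t. t powr (-1/2)) has_integral (c powr (-1/2+1) / (-1/2+1))) {0..c}"
    using assms by (intro has_integral_powr_from_0) auto
  then have "((\<lambda>t. t powr (-1/2)) has_integral (2 * sqrt c)) {0..c}"
    using assms by (simp add: powr_half_sqrt mult.commute)
  then have "((\<lambda>t. if t \<in> {0..c} then t powr (-1/2) else 0) has_integral (2 * sqrt c)) UNIV"
    by (subst has_integral_restrict_UNIV)
  moreover have "(\<lambda>t. if t \<in> {0..c} then t powr (-1/2) else 0)
      = (\<lambda>t. t powr (1/2) / t * indicator {0<..c} t)"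
  proof
    fix t :: real
    have "t powr (-1/2) = t powr (1/2) / t" if "0 < t"
      using that powr_diff[of t "1/2" 1] by simp
    then show "(if t \<in> {0..c} then t powr (-1/2) else 0) = t powr (1/2) / t * indicator {0<..c} t"
      by (cases "t = 0") (auto simp: indicator_def)
  qed
  ultimately have "((\<lambda>t. t powr (1/2) / t * indicator {0<..c} t) has_integral (2 * sqrt c)) UNIV"
    by simp
  then have "(\<integral>\<^sup>+t. ennreal (t powr (1/2) / t * indicator {0<..c} t) \<partial>lborel) = ennreal (2 * sqrt c)"
    by (intro nn_integral_has_integral_lborel) (auto simp: indicator_def)
  moreover have "ennreal (t powr (1/2) / t * indicator {0<..c} t)
      = ennreal (t powr (1/2) / t) * indicator {0<..c} t" for t
    by (auto simp: indicator_def)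
  ultimately show ?thesis
    by simp
qed

text \<open>
  If \<open>\<bar>f\<bar> > s\<close> held infinitely often, the rearrangement would be bounded below by \<open>s\<close>, and
  \<open>t powr (-1/2)\<close> is not integrable at infinity.
\<close>

lemma lorentz21_level_finite:
  assumes f: "f \<in> lorentz21" and s: "0 < s"
  shows "finite {x. s < cmod (f x)}"
proof (rule ccontr)
  assume inf: "infinite {x. s < cmod (f x)}"
  then have top: "distribution_fun f s = \<infinity>"
    by (simp add: distribution_fun_def emeasure_count_space)
  have ge: "ennreal s \<le> decreasing_rearrangement f t" for t
    unfolding decreasing_rearrangement_def
  proof (rule Inf_greatest, safe)
    fix s'
    assume s': "0 \<le> s'" "distribution_fun f s' \<le> ennreal t"
    then have "distribution_fun f s' < distribution_fun f s"
      by (simp add: top le_less_trans[OF _ ennreal_less_top])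
    then have "\<not> s' \<le> s"
      using distribution_fun_antimono[of s' s f] by auto
    then show "ennreal s \<le> ennreal s'"
      by (intro ennreal_leI) auto
  qed
  obtain L where L: "0 \<le> L" "lorentz21_norm f = ennreal L"
    using f by (cases "lorentz21_norm f") (auto simp: lorentz21_def)
  have "s * sqrt c \<le> L" if "0 \<le> c" for c
  proof -
    have "ennreal (s * sqrt c) = ennreal (1/2) * (ennreal s * ennreal (2 * sqrt c))"
      using s that by (simp del: ennreal_half flip: ennreal_mult)
    also have "\<dots> = ennreal (1/2) * (\<integral>\<^sup>+t. ennreal s * (ennreal (t powr (1/2) / t) * indicator {0<..c} t) \<partial>lborel)"
      unfolding nn_integral_half_power[OF that, symmetric]
      by (subst nn_integral_cmult) measurable
    also have "\<dots> \<le> lorentz21_norm f"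
      unfolding lorentz21_norm_def
      by (intro mult_left_mono nn_integral_mono)
         (use ge in \<open>auto simp: indicator_def intro!: mult_right_mono\<close>)
    finally show ?thesis
      using L by simp
  qed
  from this[of "((L + 1) / s)\<^sup>2"] show False
    using L s by simp
qed

lemma card_superlevel_eq_sum:
  fixes f :: "'a \<Rightarrow> complex"
  assumes fin: "finite {x. f x \<noteq> 0}" and s: "0 < s"
  shows "real (card {x. s < cmod (f x)}) = (\<Sum>x | f x \<noteq> 0. if s < cmod (f x) then 1 else 0)"
proof -
  have "{x. s < cmod (f x)} = {x \<in> {x. f x \<noteq> 0}. s < cmod (f x)}"
    using s by auto
  then show ?thesis
    using fin by (simp add: sum.If_cases Int_def)
qed

lemma layer_measurable:
  assumes fin: "finite {x. f x \<noteq> 0}"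
  shows "(\<lambda>s. ennreal (sqrt (card {x. s < cmod (f x)})) * indicator {0<..} s) \<in> borel_measurable lborel"
proof -
  have eq: "(\<lambda>s. ennreal (sqrt (card {x. s < cmod (f x)})) * indicator {0<..} s) =
      (\<lambda>s. ennreal (sqrt (\<Sum>x | f x \<noteq> 0. if s < cmod (f x) then 1 else 0)) * indicator {0<..} s)"
    using card_superlevel_eq_sum[OF fin] by (auto simp: indicator_def)
  show ?thesis
    unfolding eq by measurable
qed

text \<open>
  The layer-cake form of the norm: with \<open>d s\<close> the number of \<open>x\<close> with \<open>\<bar>f x\<bar> > s\<close>, the value of the
  rearrangement at \<open>t\<close> dominates the length of \<open>{s > 0. t < d s}\<close>. Exchange the order of
  integration and use that half the integral of \<open>t powr (-1/2)\<close> over \<open>{0<..d s}\<close> is \<open>sqrt (d s)\<close>.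
\<close>

lemma layer_cake_le_lorentz21_norm:
  assumes fin: "finite {x. f x \<noteq> 0}"
  shows "(\<integral>\<^sup>+s\<in>{0<..}. ennreal (sqrt (card {x. s < cmod (f x)})) \<partial>lborel) \<le> lorentz21_norm f"
proof -
  let ?d = "\<lambda>s. real (card {x. s < cmod (f x)})"
  let ?w = "\<lambda>t::real. ennreal (t powr (1/2) / t)"
  define A where "A s t = (indicator {0<..} s * indicator {0<..} t * (if t < ?d s then 1 else 0) :: ennreal)"
    for s t
  have fin': "finite {x. s < cmod (f x)}" if "0 < s" for s
    using that by (intro finite_subset[OF _ fin]) auto
  have d: "?d s = (\<Sum>x | f x \<noteq> 0. if s < cmod (f x) then 1 else 0)" if "0 < s" for s
    by (rule card_superlevel_eq_sum[OF fin that])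
  have A: "A s t = indicator {0<..} s * indicator {0<..} t *
      (if t < (\<Sum>x | f x \<noteq> 0. if s < cmod (f x) then 1 else 0) then 1 else 0)" for s t
    using d by (auto simp: A_def indicator_def)
  have [measurable]: "(\<lambda>(s,t). A s t) \<in> borel_measurable (lborel \<Otimes>\<^sub>M lborel)"
    unfolding A by measurable
  have "(\<integral>\<^sup>+s\<in>{0<..}. ennreal (sqrt (?d s)) \<partial>lborel)
      = (\<integral>\<^sup>+s. ennreal (1/2) * (\<integral>\<^sup>+t. A s t * ?w t \<partial>lborel) \<partial>lborel)"
  proof (rule nn_integral_cong)
    fix s :: real
    have "ennreal (1/2) * (\<integral>\<^sup>+t. A s t * ?w t \<partial>lborel) = ennreal (sqrt (?d s))" if "0 < s"
    proof -
      have "(\<integral>\<^sup>+t. A s t * ?w t \<partial>lborel) = (\<integral>\<^sup>+t. ?w t * indicator {0<..?d s} t \<partial>lborel)"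
      proof (rule nn_integral_cong_AE)
        show "AE t in lborel. A s t * ?w t = ?w t * indicator {0<..?d s} t"
          by (rule eventually_mono[OF AE_lborel_singleton[of "?d s"]])
             (use that in \<open>auto simp: A_def indicator_def\<close>)
      qed
      then show ?thesis
        by (simp add: nn_integral_half_power del: ennreal_half flip: ennreal_mult)
    qed
    moreover have "A s t = 0" if "\<not> 0 < s" for t
      using that by (simp add: A_def)
    ultimately show "ennreal (sqrt (?d s)) * indicator {0<..} s
        = ennreal (1/2) * (\<integral>\<^sup>+t. A s t * ?w t \<partial>lborel)"
      by (cases "0 < s") (auto simp: indicator_def)
  qed
  also have "\<dots> = ennreal (1/2) * (\<integral>\<^sup>+s. \<integral>\<^sup>+t. A s t * ?w t \<partial>lborel \<partial>lborel)"
    by (subst nn_integral_cmult) measurable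
  also have "(\<integral>\<^sup>+s. \<integral>\<^sup>+t. A s t * ?w t \<partial>lborel \<partial>lborel) = (\<integral>\<^sup>+t. \<integral>\<^sup>+s. A s t * ?w t \<partial>lborel \<partial>lborel)"
    by (rule lborel_pair.Fubini') measurable
  also have "\<dots> \<le> (\<integral>\<^sup>+t\<in>{0<..}. decreasing_rearrangement f t * ?w t \<partial>lborel)"
  proof (rule nn_integral_mono)
    fix t :: real
    have "(\<integral>\<^sup>+s. A s t \<partial>lborel) \<le> decreasing_rearrangement f t" if "0 < t"
      unfolding decreasing_rearrangement_def
    proof (rule Inf_greatest, safe)
      fix s0
      assume s0: "0 \<le> s0" "distribution_fun f s0 \<le> ennreal t"
      have "A s t \<le> indicator {0..s0} s" for s
      proof (cases "0 < s \<and> s0 < s")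
        case True
        have "ennreal (?d s) \<le> ennreal t"
          using distribution_fun_antimono[of s0 s f] s0 distribution_fun_finite[OF fin', of s] True
          by (auto intro: order_trans)
        then show ?thesis
          using that by (simp add: A_def)
      qed (auto simp: A_def indicator_def)
      then have "(\<integral>\<^sup>+s. A s t \<partial>lborel) \<le> (\<integral>\<^sup>+s. indicator {0..s0} s \<partial>lborel)"
        by (intro nn_integral_mono)
      then show "(\<integral>\<^sup>+s. A s t \<partial>lborel) \<le> ennreal s0"
        using s0 by simp
    qed
    moreover have "(\<integral>\<^sup>+s. A s t * ?w t \<partial>lborel) = (\<integral>\<^sup>+s. A s t \<partial>lborel) * ?w t"
      by (rule nn_integral_multc) measurable
    moreover have "A s t = 0" if "\<not> 0 < t" for s
      using that by (simp add: A_def)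
    ultimately show "(\<integral>\<^sup>+s. A s t * ?w t \<partial>lborel)
        \<le> decreasing_rearrangement f t * ?w t * indicator {0<..} t"
      by (cases "0 < t") (auto intro!: mult_right_mono)
  qed
  finally show ?thesis
    unfolding lorentz21_norm_def by (simp add: mult_left_mono)
qed

text \<open>
  Each set \<open>{x. \<bar>f x\<bar> > s}\<close> is finite, hence eventually inside \<open>B k\<close>. So the rearrangements of the
  tails tend to \<open>0\<close> pointwise, and they are dominated by the rearrangement of \<open>f\<close>.
\<close>

lemma lorentz21_tail:
  assumes f: "f \<in> lorentz21" and B: "\<And>x. \<exists>k0. \<forall>k\<ge>k0. x \<in> B k"
  shows "(\<lambda>k. lorentz21_norm (\<lambda>x. if x \<in> B k then 0 else f x)) \<longlonglongrightarrow> 0"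
proof -
  let ?h = "\<lambda>k x. if x \<in> B k then 0 else f x"
  let ?w = "\<lambda>t::real. ennreal (t powr (1/2) / t) * indicator {0<..} t"
  have le: "decreasing_rearrangement (?h k) t \<le> decreasing_rearrangement f t" for k t
    by (rule rearrangement_mono) auto
  have lim: "(\<lambda>k. decreasing_rearrangement (?h k) t) \<longlonglongrightarrow> 0" for t
  proof (rule order_tendstoI)
    fix a :: ennreal
    assume "0 < a"
    then obtain b where b: "0 < b" "b < a"
      using dense by blast
    then obtain s where "0 \<le> s" "b = ennreal s"
      by (cases b) auto
    then have s: "0 < s" "ennreal s < a"
      using b by auto
    have "\<forall>x. \<forall>\<^sub>F k in sequentially. x \<in> B k"
      using B by (simp add: eventually_sequentially)
    then have "\<forall>\<^sub>F k in sequentially. \<forall>x\<in>{x. s < cmod (f x)}. x \<in> B k"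
      by (intro eventually_ball_finite lorentz21_level_finite[OF f s(1)]) auto
    then show "\<forall>\<^sub>F k in sequentially. decreasing_rearrangement (?h k) t < a"
    proof eventually_elim
      fix k
      assume "\<forall>x\<in>{x. s < cmod (f x)}. x \<in> B k"
      then have "{x. s < cmod (?h k x)} = {}"
        using s by auto
      then have "distribution_fun (?h k) s = 0"
        unfolding distribution_fun_def by simp
      then have "decreasing_rearrangement (?h k) t \<le> ennreal s"
        using s by (intro rearrangement_le) auto
      then show "decreasing_rearrangement (?h k) t < a"
        using s by auto
    qed
  qed auto
  have "(\<lambda>k. \<integral>\<^sup>+t. decreasing_rearrangement (?h k) t * ?w t \<partial>lborel) \<longlonglongrightarrow> (\<integral>\<^sup>+(t::real). 0 \<partial>lborel)"
  proof (rule nn_integral_dominated_convergence)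
    show "(\<integral>\<^sup>+t. decreasing_rearrangement f t * ?w t \<partial>lborel) < \<infinity>"
    proof -
      have "lorentz21_norm f < \<infinity>"
        using f by (simp add: lorentz21_def)
      then show ?thesis
        unfolding lorentz21_norm_def by (auto simp: ennreal_mult_less_top mult.assoc)
    qed
    show "AE t in lborel. (\<lambda>k. decreasing_rearrangement (?h k) t * ?w t) \<longlonglongrightarrow> 0"
    proof (rule AE_I2)
      fix t
      have "(\<lambda>k. decreasing_rearrangement (?h k) t * ?w t) \<longlonglongrightarrow> 0 * ?w t"
        by (intro tendsto_mult_ennreal lim tendsto_const) (auto simp: indicator_def)
      then show "(\<lambda>k. decreasing_rearrangement (?h k) t * ?w t) \<longlonglongrightarrow> 0"
        by simp
    qed
  qed (use le in \<open>auto intro!: mult_right_mono\<close>)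
  then have "(\<lambda>k. ennreal (1/2) * (\<integral>\<^sup>+t. decreasing_rearrangement (?h k) t * ?w t \<partial>lborel))
      \<longlonglongrightarrow> ennreal (1/2) * 0"
    by (intro tendsto_mult_ennreal tendsto_const) auto
  then show ?thesis
    unfolding lorentz21_norm_def by (simp add: mult.assoc)
qed

section \<open>Geodesics towards the root\<close>

locale rooted_tree =
  fixes adj :: "'a \<Rightarrow> 'a \<Rightarrow> bool" and q :: nat and v0 :: 'a
  assumes tree: "homogeneous_tree adj q"
begin

abbreviation level :: "'a \<Rightarrow> nat" where
  "level \<equiv> gdist adj v0"

lemma adj_sym: "adj x y \<Longrightarrow> adj y x"
  using tree by (auto simp: homogeneous_tree_def symp_def)

lemma no_cycle: "\<not> graph_cycle adj xs"
  using tree by (auto simp: homogeneous_tree_def)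

lemma walk_gdist: "(adj ^^ gdist adj x y) x y"
proof -
  have "adj\<^sup>*\<^sup>* x y"
    using tree by (auto simp: homogeneous_tree_def)
  then obtain n where "(adj ^^ n) x y"
    using rtranclp_imp_relpowp by metis
  then show ?thesis
    unfolding gdist_def by (rule LeastI)
qed

lemma gdist_le_walk: "(adj ^^ n) x y \<Longrightarrow> gdist adj x y \<le> n"
  unfolding gdist_def by (rule Least_le)

lemma gdist_1_adj: "gdist adj x y = 1 \<Longrightarrow> adj x y"
  using walk_gdist[of x y] by auto

lemma level_root: "level v0 = 0"
  using gdist_le_walk[of 0 v0 v0] by auto

lemma level_0_iff: "level x = 0 \<longleftrightarrow> x = v0"
  using walk_gdist[of v0 x] level_root by auto

lemma level_adj_le: "adj x y \<Longrightarrow> level y \<le> Suc (level x)"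
  using gdist_le_walk[OF relpowp_Suc_I[OF walk_gdist]] .

lemma ex_upper_neighbour:
  assumes "level x = Suc n"
  shows "\<exists>y. adj y x \<and> level y = n"
proof -
  have "(adj ^^ Suc n) v0 x"
    using walk_gdist[of v0 x] assms by simp
  then obtain y where y: "(adj ^^ n) v0 y" "adj y x"
    by (elim relpowp_Suc_E)
  have "level y \<le> n" "level x \<le> Suc (level y)"
    using y by (auto intro: gdist_le_walk level_adj_le)
  then show ?thesis
    using y assms by (intro exI[of _ y]) auto
qed

lemma ex_descending_path:
  "level y = n \<Longrightarrow> \<exists>p. p n = y \<and> (\<forall>k\<le>n. level (p k) = k) \<and> (\<forall>k<n. adj (p k) (p (Suc k)))"
proof (induction n arbitrary: y)
  case 0
  then show ?case
    by (intro exI[of _ "\<lambda>_. y"]) auto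
next
  case (Suc n)
  obtain y' where y': "adj y' y" "level y' = n"
    using ex_upper_neighbour[OF Suc.prems] by auto
  obtain p where p: "p n = y'" "\<forall>k\<le>n. level (p k) = k" "\<forall>k<n. adj (p k) (p (Suc k))"
    using Suc.IH[OF y'(2)] by auto
  show ?case
    using p y' Suc.prems
    by (intro exI[of _ "p(Suc n := y)"]) (auto simp: le_Suc_eq less_Suc_eq)
qed

text \<open>
  Two different upper neighbours of \<open>x\<close> would yield a cycle: follow geodesics from both of them
  towards the root until they first meet.
\<close>

lemma upper_neighbour_unique:
  assumes "adj y x" "adj y' x" "level x = Suc n" "level y = n" "level y' = n"
  shows "y = y'"
proof (rule ccontr)
  assume "y \<noteq> y'"
  obtain p where p: "p n = y" "\<And>k. k \<le> n \<Longrightarrow> level (p k) = k"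
      "\<And>k. k < n \<Longrightarrow> adj (p k) (p (Suc k))"
    using ex_descending_path[OF assms(4)] by metis
  obtain p' where p': "p' n = y'" "\<And>k. k \<le> n \<Longrightarrow> level (p' k) = k"
      "\<And>k. k < n \<Longrightarrow> adj (p' k) (p' (Suc k))"
    using ex_descending_path[OF assms(5)] by metis
  define A where "A = {k. k \<le> n \<and> p k = p' k}"
  have "finite A" "A \<subseteq> {..n}"
    by (auto simp: A_def)
  have "p 0 = p' 0"
    using p(2)[of 0] p'(2)[of 0] level_0_iff by simp
  then have "0 \<in> A"
    by (simp add: A_def)
  define m where "m = Max A"
  have "m \<in> A"
    unfolding m_def using \<open>0 \<in> A\<close> \<open>finite A\<close> Max_in by blast
  then have m: "p m = p' m" "m < n"
    using \<open>y \<noteq> y'\<close> p(1) p'(1) by (auto simp: A_def le_less)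
  have ne: "p k \<noteq> p' k" if "m < k" "k \<le> n" for k
    using that Max_ge[OF \<open>finite A\<close>, of k] unfolding m_def[symmetric] by (auto simp: A_def)
  define xs where "xs = map p [m..<Suc n] @ [x] @ rev (map p' [Suc m..<Suc n])"
  have inj: "inj_on p {..n}" "inj_on p' {..n}"
    using p(2) p'(2) by (auto intro!: inj_onI) (metis p(2), metis p'(2))
  have "graph_cycle adj xs"
    unfolding graph_cycle_def
  proof (intro conjI)
    show "3 \<le> length xs"
      using m by (simp add: xs_def)
    have "x \<notin> p ` {m..n}" "x \<notin> p' ` {Suc m..n}"
      using p(2) p'(2) assms(3) by force+
    moreover have "p i \<noteq> p' j" if "m \<le> i" "i \<le> n" "Suc m \<le> j" "j \<le> n" for i j
      using ne[of j] p(2)[of i] p'(2)[of j] that by force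
    then have "p ` {m..n} \<inter> p' ` {Suc m..n} = {}"
      by auto
    ultimately show "distinct xs"
      unfolding xs_def using inj
      by (auto simp: distinct_map atLeastLessThanSuc_atLeastAtMost intro: inj_on_subset
          simp del: upt_Suc)
    have 1: "successively adj (map p [m..<Suc n])"
      unfolding successively_map
      by (subst successively_conv_nth) (use p(3) in \<open>auto simp del: upt_Suc\<close>)
    have 2: "successively adj (rev (map p' [Suc m..<Suc n]))"
      unfolding successively_rev successively_map
      by (subst successively_conv_nth) (use p'(3) in \<open>auto simp del: upt_Suc intro: adj_sym\<close>)
    have "hd (rev (map p' [Suc m..<Suc n])) = y'" "last (map p [m..<Suc n]) = y"
      using m p(1) p'(1) by (simp_all add: hd_rev)
    with 1 2 m assms(1,2) show "successively adj xs"
      unfolding xs_def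
      by (auto simp: successively_append_iff successively_Cons intro: adj_sym simp del: upt_Suc)
    have "hd xs = p m" "last xs = p' (Suc m)"
      using m by (simp_all add: xs_def hd_append last_rev hd_map upt_conv_Cons del: upt_Suc)
    then show "adj (last xs) (hd xs)"
      using p'(3)[of m] m by (auto intro: adj_sym)
  qed
  then show False
    using no_cycle by simp
qed

definition parent :: "'a \<Rightarrow> 'a" where
  "parent x = (SOME y. adj y x \<and> level x = Suc (level y))"

lemma parent_eqI: "adj y x \<Longrightarrow> level x = Suc (level y) \<Longrightarrow> parent x = y"
  unfolding parent_def by (rule some_equality) (auto intro: upper_neighbour_unique)

lemma parent:
  assumes "0 < level x"
  shows "adj (parent x) x" "level x = Suc (level (parent x))"
proof -
  obtain y where "adj y x" "level x = Suc (level y)"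
    using ex_upper_neighbour[of x "level x - 1"] assms by auto
  then show "adj (parent x) x" "level x = Suc (level (parent x))"
    using parent_eqI by auto
qed

text \<open>
  The \<open>k\<close>-th vertex of the geodesic from the root to \<open>x\<close>, provided that \<open>k \<le> level x\<close>; for larger
  \<open>k\<close> the value is \<open>x\<close>.
\<close>

definition ancestor :: "'a \<Rightarrow> nat \<Rightarrow> 'a" where
  "ancestor x k = (parent ^^ (level x - k)) x"

lemma ancestor_level [simp]: "ancestor x (level x) = x"
  by (simp add: ancestor_def)

lemma ancestor_parent: "k < level x \<Longrightarrow> ancestor x k = ancestor (parent x) k"
proof -
  assume "k < level x"
  then have "level x - k = Suc (level (parent x) - k)"
    using parent(2)[of x] by simp
  then show ?thesis
    by (simp add: ancestor_def funpow_swap1)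
qed

lemma level_ancestor [simp]: "k \<le> level x \<Longrightarrow> level (ancestor x k) = k"
proof (induction "level x" arbitrary: x)
  case (Suc n)
  show ?case
  proof (cases "k = level x")
    case False
    then have "k < level x" "level (parent x) = n"
      using Suc parent(2)[of x] by auto
    moreover have "k \<le> level (parent x)"
      using calculation Suc.hyps(2) by simp
    ultimately have "k < level x" "k \<le> level (parent x)" "level (parent x) = n"
      by auto
    then show ?thesis
      using Suc.hyps(1)[of "parent x"] ancestor_parent[of k x] Suc.prems by auto
  qed auto
next
  case 0
  then show ?case
    using ancestor_level[of x] by (metis le_zero_eq)
qed

lemma ancestor_0: "ancestor x 0 = v0"
  using level_ancestor[of 0 x] level_0_iff[of "ancestor x 0"] by simp

lemma ancestor_ancestor:
  assumes "j \<le> k" "k \<le> level x"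
  shows "ancestor (ancestor x k) j = ancestor x j"
proof -
  have "level x - j = (k - j) + (level x - k)"
    using assms by simp
  then have "ancestor x j = (parent ^^ (k - j)) (ancestor x k)"
    by (simp add: ancestor_def funpow_add)
  then show ?thesis
    using level_ancestor[OF assms(2)] ancestor_def[of "ancestor x k" j] by simp
qed

text \<open>
  An edge raises the level by at most one. A path that reaches level \<open>n\<close> in \<open>n\<close> steps therefore
  rises in each step, and each of its vertices is the parent of the next one.
\<close>

lemma geodesic_from_root_unique:
  assumes "xs \<noteq> []" "hd xs = v0" "successively adj xs" "length xs = Suc (level (last xs))"
  shows "xs = map (ancestor (last xs)) [0..<length xs]"
  using assms
proof (induction xs rule: rev_induct)
  case (snoc x ys)
  show ?case
  proof (cases "ys = []")
    case True
    then show ?thesis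
      using snoc.prems by (auto simp: level_root ancestor_0)
  next
    case False
    have lev: "level (last zs) < length zs" if "zs \<noteq> []" "hd zs = v0" "successively adj zs" for zs
      using that
    proof (induction zs rule: rev_induct)
      case (snoc z zs)
      then show ?case
        using level_adj_le[of "last zs" z]
        by (cases "zs = []") (auto simp: level_root successively_append_iff)
    qed auto
    have ys: "hd ys = v0" "successively adj ys" "adj (last ys) x"
      using snoc.prems False by (auto simp: successively_append_iff)
    have "level (last ys) < length ys" "level x \<le> Suc (level (last ys))" "length ys = level x"
      using lev[OF False ys(1,2)] level_adj_le[OF ys(3)] snoc.prems by auto
    then have len: "length ys = Suc (level (last ys))" "level x = length ys"
      by auto
    have par: "parent x = last ys"
      using ys(3) len by (intro parent_eqI) auto
    have "ys = map (ancestor (last ys)) [0..<length ys]"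
      using snoc.IH False ys len by simp
    also have "\<dots> = map (ancestor x) [0..<length ys]"
      using len par by (intro map_cong) (auto simp: ancestor_parent)
    finally have "ys = map (ancestor x) [0..<length ys]" .
    moreover have "ancestor x (length ys) = x"
      using len(2) ancestor_level[of x] by metis
    ultimately show ?thesis
      by simp
  qed
qed auto

lemma adj_ancestor: "k < level x \<Longrightarrow> adj (ancestor x k) (ancestor x (Suc k))"
proof -
  assume k: "k < level x"
  have "level x - k = Suc (level x - Suc k)"
    using k by simp
  then have "ancestor x k = parent (ancestor x (Suc k))"
    by (simp add: ancestor_def)
  then show ?thesis
    using parent(1)[of "ancestor x (Suc k)"] k by simp
qed

lemma geodesic_from_root: "geodesic adj v0 x = map (ancestor x) [0..<Suc (level x)]"
  unfolding geodesic_def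
proof (rule the_equality)
  let ?xs = "map (ancestor x) [0..<Suc (level x)]"
  have "successively adj ?xs"
    unfolding successively_map
    by (subst successively_conv_nth) (auto simp del: upt_Suc intro: adj_ancestor)
  moreover have "hd ?xs = v0"
    by (simp add: hd_map ancestor_0 del: upt_Suc)
  ultimately show "?xs \<noteq> [] \<and> hd ?xs = v0 \<and> last ?xs = x \<and> successively adj ?xs \<and>
      length ?xs = level x + 1"
    by simp
next
  fix xs
  assume "xs \<noteq> [] \<and> hd xs = v0 \<and> last xs = x \<and> successively adj xs \<and> length xs = level x + 1"
  then show "xs = map (ancestor x) [0..<Suc (level x)]"
    using geodesic_from_root_unique[of xs] by auto
qed

lemma level_boundary: "\<omega> \<in> boundary adj v0 \<Longrightarrow> level (\<omega> n) = n"
  unfolding boundary_def by (metis (mono_tags, lifting) diff_zero le0 mem_Collect_eq)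

lemma ancestor_boundary:
  assumes "\<omega> \<in> boundary adj v0" "k \<le> n"
  shows "ancestor (\<omega> n) k = \<omega> k"
  using assms(2)
proof (induction n)
  case (Suc n)
  have lev: "level (\<omega> m) = m" for m
    using level_boundary[OF assms(1)] .
  show ?case
  proof (cases "k = Suc n")
    case True
    then show ?thesis
      using lev[of "Suc n"] ancestor_level[of "\<omega> (Suc n)"] by simp
  next
    case False
    have "\<forall>m n. m \<le> n \<longrightarrow> gdist adj (\<omega> m) (\<omega> n) = n - m"
      using assms(1) by (simp add: boundary_def)
    then have "gdist adj (\<omega> n) (\<omega> (Suc n)) = Suc n - n"
      using le_SucI by blast
    then have "adj (\<omega> n) (\<omega> (Suc n))"
      using gdist_1_adj[of "\<omega> n" "\<omega> (Suc n)"] by simp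
    then have "parent (\<omega> (Suc n)) = \<omega> n"
      by (rule parent_eqI) (simp add: lev)
    then show ?thesis
      using Suc False ancestor_parent[of k "\<omega> (Suc n)"] lev by simp
  qed
qed (use level_boundary[OF assms(1), of 0] ancestor_level[of "\<omega> 0"] in simp)

abbreviation cyl :: "'a \<Rightarrow> (nat \<Rightarrow> 'a) set" where
  "cyl \<equiv> boundary_cyl adj v0"

lemma cyl_ancestor_iff:
  "\<omega> \<in> boundary adj v0 \<Longrightarrow> k \<le> level x \<Longrightarrow> \<omega> \<in> cyl (ancestor x k) \<longleftrightarrow> \<omega> k = ancestor x k"
  by (simp add: boundary_cyl_def)

lemma cyl_mono:
  assumes "\<omega> \<in> cyl x" "k \<le> level x"
  shows "\<omega> \<in> cyl (ancestor x k)" "\<omega> k = ancestor x k"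
proof -
  have w: "\<omega> \<in> boundary adj v0" "\<omega> (level x) = x"
    using assms(1) by (auto simp: boundary_cyl_def)
  show "\<omega> k = ancestor x k"
    using ancestor_boundary[OF w(1) assms(2)] w(2) by simp
  then show "\<omega> \<in> cyl (ancestor x k)"
    using cyl_ancestor_iff[OF w(1) assms(2)] by simp
qed

lemma cyl_root: "cyl v0 = boundary adj v0"
  by (auto simp: boundary_cyl_def boundary_def level_root)

text \<open>The level of the confluence point of \<open>x\<close> and \<open>\<omega>\<close>.\<close>

definition meet :: "'a \<Rightarrow> (nat \<Rightarrow> 'a) \<Rightarrow> nat" where
  "meet x \<omega> = Max {k. k \<le> level x \<and> \<omega> k = ancestor x k}"

lemma
  assumes w: "\<omega> \<in> boundary adj v0"
  shows meet_le: "meet x \<omega> \<le> level x"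
    and cyl_ancestor_iff_meet: "k \<le> level x \<Longrightarrow> \<omega> \<in> cyl (ancestor x k) \<longleftrightarrow> k \<le> meet x \<omega>"
proof -
  let ?A = "{k. k \<le> level x \<and> \<omega> k = ancestor x k}"
  have fin: "finite ?A"
    by (rule finite_subset[of _ "{..level x}"]) auto
  have "0 \<in> ?A"
    using w by (auto simp: ancestor_0 boundary_def)
  then have M: "meet x \<omega> \<in> ?A"
    unfolding meet_def using fin Max_in by blast
  then show "meet x \<omega> \<le> level x"
    by simp
  assume k: "k \<le> level x"
  have "\<omega> k = ancestor x k" if "k \<le> meet x \<omega>"
    using ancestor_boundary[OF w that] ancestor_ancestor[OF that, of x] M by simp
  moreover have "k \<le> meet x \<omega>" if "\<omega> k = ancestor x k"
    unfolding meet_def using fin k that by (intro Max_ge) auto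
  ultimately show "\<omega> \<in> cyl (ancestor x k) \<longleftrightarrow> k \<le> meet x \<omega>"
    using cyl_ancestor_iff[OF w k] by auto
qed

text \<open>
  A ray through a vertex passes through all ancestors of that vertex. The vertices of the geodesic to
  \<open>x\<close> that lie on \<open>\<omega>\<close> are thus an initial segment, and the last of them has level \<open>meet x \<omega>\<close>.
\<close>

lemma horo_height_eq:
  assumes w: "\<omega> \<in> boundary adj v0"
  shows "horo_height adj v0 x \<omega> = 2 * int (meet x \<omega>) - int (level x)"
proof -
  have mem: "ancestor x k \<in> range \<omega> \<longleftrightarrow> k \<le> meet x \<omega>" if "k \<le> level x" for k
  proof -
    have "ancestor x k \<in> range \<omega> \<longleftrightarrow> \<omega> k = ancestor x k"
      using level_boundary[OF w] level_ancestor[OF that] by (metis rangeE rangeI)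
    then show ?thesis
      using cyl_ancestor_iff[OF w that] cyl_ancestor_iff_meet[OF w that] by simp
  qed
  then have "filter ((\<lambda>v. v \<in> range \<omega>) \<circ> ancestor x) [0..<Suc (level x)]
      = filter (\<lambda>k. k \<le> meet x \<omega>) [0..<Suc (level x)]"
    by (intro filter_cong refl) (simp add: mem less_Suc_eq_le del: upt_Suc)
  also have "\<dots> = filter (\<lambda>k. k \<le> meet x \<omega>)
      ([0..<Suc (meet x \<omega>)] @ [Suc (meet x \<omega>)..<Suc (level x)])"
    using upt_add_eq_append[of 0 "Suc (meet x \<omega>)" "level x - meet x \<omega>"] meet_le[OF w, of x]
    by simp
  also have "\<dots> = [0..<Suc (meet x \<omega>)]"
    by (subst filter_append, subst filter_True, simp, subst filter_False) auto
  finally have on_ray: "filter ((\<lambda>v. v \<in> range \<omega>) \<circ> ancestor x) [0..<Suc (level x)]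
      = [0..<Suc (meet x \<omega>)]" .
  have "confluent adj v0 x \<omega> = ancestor x (meet x \<omega>)"
    unfolding confluent_def geodesic_from_root filter_map on_ray by simp
  then show ?thesis
    using meet_le[OF w] by (simp add: horo_height_def)
qed

lemma finite_ball: "finite {x. level x \<le> n}"
proof (induction n)
  case 0
  have "{x. level x \<le> 0} = {v0}"
    by (auto simp: level_0_iff)
  then show ?case
    by simp
next
  case (Suc n)
  have "{x. level x \<le> Suc n} \<subseteq> {x. level x \<le> n} \<union> (\<Union>y\<in>{x. level x \<le> n}. {z. adj y z})"
    using ex_upper_neighbour by (fastforce simp: le_Suc_eq)
  moreover have "finite {z. adj y z}" for y
    using tree by (auto simp: homogeneous_tree_def)
  ultimately show ?case
    using Suc.IH by (meson finite_UN_I finite_Un finite_subset)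
qed

end

section \<open>Martingale differences on the boundary\<close>

locale tree_boundary = rooted_tree +
  fixes \<nu> :: "(nat \<Rightarrow> 'a) measure"
  assumes q_ge_2: "2 \<le> q" and bm: "boundary_measure adj q v0 \<nu>"
begin

sublocale prob_space \<nu>
  using bm by (simp add: boundary_measure_def)

lemma space_\<nu>: "space \<nu> = boundary adj v0"
  using bm by (simp add: boundary_measure_def)

lemma sets_cyl [measurable]: "cyl x \<in> sets \<nu>"
  using bm by (auto simp: boundary_measure_def intro: sigma_sets.Basic)

definition mass :: "'a \<Rightarrow> real" where
  "mass x = measure \<nu> (cyl x)"

lemma mass_root: "mass v0 = 1"
  by (simp add: mass_def cyl_root flip: space_\<nu>) (rule prob_space)

lemma mass_eq: "1 \<le> level x \<Longrightarrow> mass x = real q / ((real q + 1) * real q ^ level x)"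
  using bm by (simp add: boundary_measure_def mass_def measure_def)

lemma mass_bounds:
  shows "0 < mass x" "real q ^ level x \<le> 1 / mass x" "1 / mass x \<le> 2 * real q ^ level x"
proof -
  have "0 < mass x \<and> real q ^ level x \<le> 1 / mass x \<and> 1 / mass x \<le> 2 * real q ^ level x"
  proof (cases "level x = 0")
    case True
    then show ?thesis
      using mass_root by (simp add: level_0_iff level_root)
  next
    case False
    then have inv: "1 / mass x = (real q + 1) / real q * real q ^ level x"
      by (simp add: mass_eq)
    have "1 \<le> (real q + 1) / real q" "(real q + 1) / real q \<le> 2"
      using q_ge_2 by (simp_all add: field_simps)
    then have "1 * real q ^ level x \<le> 1 / mass x" "1 / mass x \<le> 2 * real q ^ level x"
      unfolding inv by (intro mult_right_mono; simp)+
    moreover have "0 < mass x"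
      using False q_ge_2 by (simp add: mass_eq)
    ultimately show ?thesis
      by simp
  qed
  then show "0 < mass x" "real q ^ level x \<le> 1 / mass x" "1 / mass x \<le> 2 * real q ^ level x"
    by auto
qed

text \<open>The indicator of the cylinder of \<open>x\<close>, normalised to have integral \<open>1\<close>.\<close>

definition ncyl :: "'a \<Rightarrow> (nat \<Rightarrow> 'a) \<Rightarrow> complex" where
  "ncyl x \<omega> = of_real (indicator (cyl x) \<omega> / mass x)"

lemma ncyl_L2: "ncyl x \<in> L2_space \<nu>"
proof -
  have "cmod (ncyl x \<omega>) \<le> 1 / mass x" for \<omega>
    using mass_bounds(1)[of x] by (auto simp: ncyl_def indicator_def norm_divide)
  then have "(cmod (ncyl x \<omega>))\<^sup>2 \<le> (1 / mass x)\<^sup>2" for \<omega>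
    by (intro power_mono) auto
  then have "integrable \<nu> (\<lambda>\<omega>. (cmod (ncyl x \<omega>))\<^sup>2)"
    by (intro integrable_const_bound[where B="(1 / mass x)\<^sup>2"]) (auto simp: ncyl_def)
  moreover have "ncyl x \<in> borel_measurable \<nu>"
    unfolding ncyl_def by measurable
  ultimately show ?thesis
    by (simp add: L2_space_def)
qed

lemma integral_ncyl: "(\<integral>\<omega>. ncyl x \<omega> \<partial>\<nu>) = 1"
proof -
  have "(\<integral>\<omega>. indicator (cyl x) \<omega> / mass x \<partial>\<nu>) = 1"
    using mass_bounds(1)[of x] by (simp add: mass_def)
  then show ?thesis
    unfolding ncyl_def integral_complex_of_real by simp
qed

lemma cnj_ncyl [simp]: "cnj (ncyl x \<omega>) = ncyl x \<omega>"
  by (simp add: ncyl_def)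

text \<open>
  Two cylinders are nested or disjoint, and \<open>ncyl u\<close> is constant on a cylinder inside that of \<open>u\<close>.
\<close>

lemma inner_ncyl:
  assumes "level u \<le> level y"
  shows "(\<integral>\<omega>. ncyl u \<omega> * cnj (ncyl y \<omega>) \<partial>\<nu>)
    = (if u = ancestor y (level u) then of_real (1 / mass u) else 0)"
proof (cases "u = ancestor y (level u)")
  case True
  have "ncyl u \<omega> * cnj (ncyl y \<omega>) = of_real (1 / mass u) * ncyl y \<omega>" for \<omega>
    using cyl_mono(1)[of \<omega> y "level u"] assms True[symmetric] by (auto simp: ncyl_def indicator_def)
  then show ?thesis
    using True integral_ncyl by simp
next
  case False
  have disjoint: "ncyl u \<omega> * cnj (ncyl y \<omega>) = 0" for \<omega>
    using cyl_mono(2)[of \<omega> y "level u"] assms False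
    by (auto simp: ncyl_def indicator_def boundary_cyl_def)
  show ?thesis
    unfolding disjoint using False by simp
qed

text \<open>
  The conditional expectation of \<open>ncyl x\<close> given the first \<open>k\<close> vertices of the ray is
  \<open>ncyl (ancestor x k)\<close> if \<open>k \<le> level x\<close>, and \<open>ncyl x\<close> afterwards. These are the differences of
  this martingale.
\<close>

definition mdiff :: "'a \<Rightarrow> nat \<Rightarrow> (nat \<Rightarrow> 'a) \<Rightarrow> complex" where
  "mdiff x k \<omega> = (if k \<le> level x
     then ncyl (ancestor x k) \<omega> - (if k = 0 then 0 else ncyl (ancestor x (k - 1)) \<omega>) else 0)"

lemma mdiff_L2: "mdiff x k \<in> L2_space \<nu>"
proof -
  have "(\<lambda>_. 0) \<in> L2_space \<nu>"
    by (simp add: L2_space_def)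
  then show ?thesis
    using ncyl_L2 L2_space_diff[OF ncyl_L2 ncyl_L2] unfolding mdiff_def
    by (cases "k \<le> level x"; cases "k = 0") simp_all
qed

lemma cnj_mdiff [simp]: "cnj (mdiff x k \<omega>) = mdiff x k \<omega>"
  by (simp add: mdiff_def)

text \<open>
  The function \<open>ncyl u\<close> is constant on the cylinder of \<open>ancestor y (k - 1)\<close>, while \<open>mdiff y k\<close>
  vanishes off that cylinder and has integral \<open>0\<close>.
\<close>

lemma inner_ncyl_mdiff:
  assumes "level u < k"
  shows "(\<integral>\<omega>. ncyl u \<omega> * cnj (mdiff y k \<omega>) \<partial>\<nu>) = 0"
proof (cases "k \<le> level y")
  case True
  have "(\<integral>\<omega>. ncyl u \<omega> * cnj (mdiff y k \<omega>) \<partial>\<nu>)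
      = (\<integral>\<omega>. ncyl u \<omega> * cnj (ncyl (ancestor y k) \<omega>) - ncyl u \<omega> * cnj (ncyl (ancestor y (k - 1)) \<omega>) \<partial>\<nu>)"
    using assms True by (simp add: mdiff_def algebra_simps)
  also have "\<dots> = (\<integral>\<omega>. ncyl u \<omega> * cnj (ncyl (ancestor y k) \<omega>) \<partial>\<nu>)
      - (\<integral>\<omega>. ncyl u \<omega> * cnj (ncyl (ancestor y (k - 1)) \<omega>) \<partial>\<nu>)"
    by (intro Bochner_Integration.integral_diff L2_space_integrable_mult ncyl_L2)
  also have "\<dots> = 0"
    using assms True by (simp add: inner_ncyl ancestor_ancestor del: cnj_ncyl)
  finally show ?thesis .
qed (simp add: mdiff_def)

lemma mdiff_orthogonal:
  assumes "j \<noteq> k"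
  shows "(\<integral>\<omega>. mdiff x j \<omega> * cnj (mdiff y k \<omega>) \<partial>\<nu>) = 0"
proof -
  have less: "(\<integral>\<omega>. mdiff x j \<omega> * cnj (mdiff y k \<omega>) \<partial>\<nu>) = 0" if "j < k" for j k x y
  proof (cases "j \<le> level x")
    case True
    have "mdiff x j \<omega> * cnj (mdiff y k \<omega>) = ncyl (ancestor x j) \<omega> * cnj (mdiff y k \<omega>)
        - (if j = 0 then 0 else 1) * (ncyl (ancestor x (j - 1)) \<omega> * cnj (mdiff y k \<omega>))" for \<omega>
      using True by (simp add: mdiff_def[of x] algebra_simps)
    then have "(\<integral>\<omega>. mdiff x j \<omega> * cnj (mdiff y k \<omega>) \<partial>\<nu>)
        = (\<integral>\<omega>. ncyl (ancestor x j) \<omega> * cnj (mdiff y k \<omega>) \<partial>\<nu>)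
          - (if j = 0 then 0 else 1) * (\<integral>\<omega>. ncyl (ancestor x (j - 1)) \<omega> * cnj (mdiff y k \<omega>) \<partial>\<nu>)"
      using L2_space_integrable_mult(1)[OF ncyl_L2 mdiff_L2]
      by (simp only:) (subst Bochner_Integration.integral_diff, auto)
    then show ?thesis
      using that True inner_ncyl_mdiff by simp
  qed (simp add: mdiff_def)
  show ?thesis
  proof (cases "j < k")
    case False
    have "(\<integral>\<omega>. mdiff x j \<omega> * cnj (mdiff y k \<omega>) \<partial>\<nu>) = (\<integral>\<omega>. mdiff y k \<omega> * cnj (mdiff x j \<omega>) \<partial>\<nu>)"
      by (simp add: mult.commute)
    then show ?thesis
      using less[of k j y x] False assms by simp
  qed (rule less)
qed

lemma sum_mdiff:
  "(\<Sum>k\<le>n. mdiff x k \<omega>) = ncyl (ancestor x (min n (level x))) \<omega>"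
proof (induction n)
  case (Suc n)
  show ?case
  proof (cases "Suc n \<le> level x")
    case True
    then show ?thesis
      using Suc.IH by (simp add: mdiff_def)
  next
    case False
    then have "min n (level x) = level x" "min (Suc n) (level x) = level x"
      by auto
    then show ?thesis
      using Suc.IH False by (simp add: mdiff_def)
  qed
qed (simp add: mdiff_def)

text \<open>
  The operator that multiplies the \<open>k\<close>-th martingale difference by \<open>w ^ k\<close>, applied to \<open>ncyl x\<close>.
\<close>

definition rotated :: "complex \<Rightarrow> 'a \<Rightarrow> (nat \<Rightarrow> 'a) \<Rightarrow> complex" where
  "rotated w x \<omega> = (\<Sum>k\<le>level x. w ^ k * mdiff x k \<omega>)"

lemma rotated_L2: "rotated w x \<in> L2_space \<nu>"
  unfolding rotated_def by (intro L2_space_sum L2_space_scale mdiff_L2)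

text \<open>
  Collecting the terms of equal level decomposes both sums into the same orthogonal components, up
  to the unimodular factors \<open>w ^ k\<close>.
\<close>

lemma rotated_isometry:
  assumes "finite S" "cmod w = 1"
  shows "L2_norm \<nu> (\<lambda>\<omega>. \<Sum>x\<in>S. a x * rotated w x \<omega>) = L2_norm \<nu> (\<lambda>\<omega>. \<Sum>x\<in>S. a x * ncyl x \<omega>)"
proof -
  define N where "N = Max (insert 0 (level ` S))"
  define D where "D k \<omega> = (\<Sum>x\<in>S. a x * mdiff x k \<omega>)" for k \<omega>
  have N: "level x \<le> N" if "x \<in> S" for x
    unfolding N_def using assms(1) that by (intro Max_ge) auto
  have D: "D k \<in> L2_space \<nu>" for k
    unfolding D_def by (intro L2_space_sum L2_space_scale mdiff_L2)
  have orth: "(\<integral>\<omega>. D j \<omega> * cnj (D k \<omega>) \<partial>\<nu>) = 0" if "j \<noteq> k" for j k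
  proof -
    have "(\<integral>\<omega>. D j \<omega> * cnj (D k \<omega>) \<partial>\<nu>)
        = (\<integral>\<omega>. (\<Sum>x\<in>S. \<Sum>y\<in>S. a x * cnj (a y) * (mdiff x j \<omega> * cnj (mdiff y k \<omega>))) \<partial>\<nu>)"
      unfolding D_def by (intro Bochner_Integration.integral_cong refl)
        (simp add: sum_product mult_ac)
    also have "\<dots> = (\<Sum>x\<in>S. \<Sum>y\<in>S. a x * cnj (a y) * (\<integral>\<omega>. mdiff x j \<omega> * cnj (mdiff y k \<omega>) \<partial>\<nu>))"
      using L2_space_integrable_mult(1)[OF mdiff_L2 mdiff_L2]
      by (simp add: Bochner_Integration.integral_sum del: cnj_mdiff)
    also have "\<dots> = 0"
      using mdiff_orthogonal[OF that] by simp
    finally show ?thesis .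
  qed
  have norm: "(L2_norm \<nu> (\<lambda>\<omega>. \<Sum>k\<le>N. c k * D k \<omega>))\<^sup>2 = (\<Sum>k\<le>N. (L2_norm \<nu> (D k))\<^sup>2)"
    if "\<And>k. cmod (c k) = 1" for c
    using L2_norm_orthogonal_sum[of "{..N}" D \<nu> c] D orth that by simp
  have sum: "(\<Sum>k\<le>N. c k * D k \<omega>) = (\<Sum>x\<in>S. a x * (\<Sum>k\<le>level x. c k * mdiff x k \<omega>))" for c \<omega>
  proof -
    have "(\<Sum>k\<le>N. c k * mdiff x k \<omega>) = (\<Sum>k\<le>level x. c k * mdiff x k \<omega>)" if "x \<in> S" for x
      using N[OF that] by (intro sum.mono_neutral_right) (auto simp: mdiff_def)
    then have "(\<Sum>x\<in>S. a x * (\<Sum>k\<le>level x. c k * mdiff x k \<omega>)) = (\<Sum>x\<in>S. a x * (\<Sum>k\<le>N. c k * mdiff x k \<omega>))"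
      by simp
    also have "\<dots> = (\<Sum>k\<le>N. c k * D k \<omega>)"
      unfolding D_def sum_distrib_left by (subst sum.swap) (simp add: mult_ac)
    finally show ?thesis ..
  qed
  have "(L2_norm \<nu> (\<lambda>\<omega>. \<Sum>x\<in>S. a x * rotated w x \<omega>))\<^sup>2 = (\<Sum>k\<le>N. (L2_norm \<nu> (D k))\<^sup>2)"
    using norm[of "\<lambda>k. w ^ k"] assms(2) by (simp add: sum rotated_def norm_power)
  also have "\<dots> = (L2_norm \<nu> (\<lambda>\<omega>. \<Sum>x\<in>S. a x * ncyl x \<omega>))\<^sup>2"
    using norm[of "\<lambda>_. 1"] sum[of "\<lambda>_. 1"] by (simp add: sum_mdiff)
  finally show ?thesis
    by (simp add: power2_eq_iff_nonneg)
qed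

end

section \<open>The Poisson kernel as a rotated indicator\<close>

lemma abel_summation:
  fixes w :: "'b :: comm_ring_1"
  shows "(\<Sum>k\<le>n. w ^ k * (P k - (if k = 0 then 0 else P (k - 1)))) =
    w ^ n * P n + (1 - w) * (P 0 + (\<Sum>k=1..n. w ^ k * P k) - w ^ n * P n)"
  by (induction n) (simp_all add: algebra_simps)

context tree_boundary
begin

text \<open>
  Let \<open>n = level x\<close>, \<open>m = meet x \<omega>\<close> and \<open>Q = q w\<close>. The Poisson power is \<open>q powr (- s n)\<close> times
  \<open>Q ^ m\<close>, and \<open>Q ^ m\<close> telescopes into \<open>1\<close> plus the sum of \<open>(1 - 1 / Q) Q ^ k\<close> over \<open>1 \<le> k \<le> m\<close>.
  As \<open>k \<le> m\<close> says that \<open>\<omega>\<close> passes through \<open>ancestor x k\<close>, the factor \<open>q ^ k\<close> normalises the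
  indicator of a cylinder up to the factor \<open>q / (q + 1)\<close>, and the sum becomes \<open>c\<close> times the sum of
  the terms \<open>w ^ k ncyl (ancestor x k)\<close> over \<open>1 \<le> k \<le> n\<close>. Summation by parts rewrites it in terms of
  the differences \<open>mdiff x k\<close>, at the price of a division by \<open>1 - w\<close>.
\<close>

lemma poisson_power_expansion:
  fixes z :: real
  defines "w \<equiv> cis (2 * z * ln (real q))"
    and "s \<equiv> 1/2 + \<i> * complex_of_real z"
  defines "c \<equiv> (1 - 1 / (of_nat q * w)) * (of_nat q / (of_nat q + 1))"
  assumes \<omega>: "\<omega> \<in> boundary adj v0" and w: "w \<noteq> 1"
  shows "poisson_power adj q v0 s x \<omega> = of_nat q powr (- s * of_nat (level x)) *
    ((1 - c) + c * (1 - 1 / (1 - w)) * (w ^ level x * ncyl x \<omega>) + c / (1 - w) * rotated w x \<omega>)"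
proof -
  define n where "n = level x"
  define m where "m = meet x \<omega>"
  define Q where "Q = of_nat q * w"
  define P where "P k = ncyl (ancestor x k) \<omega>" for k
  have q: "of_nat q \<noteq> (0 :: complex)" "0 < real q"
    using q_ge_2 by auto
  have mn: "m \<le> n"
    unfolding m_def n_def by (rule meet_le[OF \<omega>])
  have cyl: "\<omega> \<in> cyl (ancestor x k) \<longleftrightarrow> k \<le> m" if "k \<le> n" for k
    using cyl_ancestor_iff_meet[OF \<omega>] that by (simp add: m_def n_def)
  have w0: "w \<noteq> 0"
    by (simp add: w_def)
  have Q: "Q \<noteq> 0"
    using q w0 by (simp add: Q_def)
  have P0: "P 0 = 1"
    using \<omega> by (simp add: P_def ancestor_0 ncyl_def mass_root cyl_root)
  have P: "c * (w ^ k * P k) = (1 - 1 / Q) * (if k \<le> m then Q ^ k else 0)" if "1 \<le> k" "k \<le> n" for k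
  proof -
    have "mass (ancestor x k) = real q / ((real q + 1) * real q ^ k)"
      using mass_eq[of "ancestor x k"] that by (simp add: n_def)
    then have "P k = (if k \<le> m then (of_nat q + 1) * of_nat q ^ k / of_nat q else 0)"
      using cyl[OF that(2)] by (simp add: P_def ncyl_def)
    moreover have "of_nat q + 1 \<noteq> (0 :: complex)"
      using of_nat_neq_0[of q, where 'a=complex] by (simp add: add.commute)
    ultimately show ?thesis
      using q by (simp add: c_def Q_def power_mult_distrib)
  qed
  have geom: "Q ^ m = 1 + (\<Sum>k=1..m. (1 - 1 / Q) * Q ^ k)"
  proof (induction m)
    case (Suc m)
    then show ?case
      using Q by (simp add: field_simps)
  qed simp
  have "(\<Sum>k=1..m. (1 - 1 / Q) * Q ^ k) = (\<Sum>k=1..n. (1 - 1 / Q) * (if k \<le> m then Q ^ k else 0))"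
    using mn by (intro sum.mono_neutral_cong_left) auto
  also have "\<dots> = (\<Sum>k=1..n. c * (w ^ k * P k))"
    by (intro sum.cong refl) (simp add: P)
  finally have Qm: "Q ^ m = 1 + c * (\<Sum>k=1..n. w ^ k * P k)"
    using geom by (simp add: sum_distrib_left)
  have "rotated w x \<omega> = (\<Sum>k\<le>n. w ^ k * (P k - (if k = 0 then 0 else P (k - 1))))"
    unfolding rotated_def n_def[symmetric]
    by (intro sum.cong refl) (simp add: mdiff_def P_def n_def)
  also have "\<dots> = w ^ n * P n + (1 - w) * (1 + (\<Sum>k=1..n. w ^ k * P k) - w ^ n * P n)"
    unfolding abel_summation P0 ..
  finally have partial_sum: "(\<Sum>k=1..n. w ^ k * P k) = (rotated w x \<omega> - w ^ n * P n) / (1 - w) - 1 + w ^ n * P n"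
    using w by (simp add: field_simps)
  have "Q ^ m = (1 - c) + c * (1 - 1 / (1 - w)) * (w ^ n * P n) + c / (1 - w) * rotated w x \<omega>"
    unfolding Qm partial_sum by (simp add: divide_inverse algebra_simps)
  moreover have "P n = ncyl x \<omega>"
    by (simp add: P_def n_def)
  moreover have "poisson_power adj q v0 s x \<omega> = of_nat q powr (- s * of_nat n) * Q ^ m"
  proof -
    let ?L = "complex_of_real (ln (real q))"
    have L: "Ln (of_nat q) = ?L"
      using q(2) by (metis Ln_of_real of_real_of_nat_eq)
    have "w = exp (2 * \<i> * of_real z * ?L)"
      unfolding w_def cis_conv_exp by (simp add: mult_ac)
    moreover have "of_nat q = exp ?L"
      using q(2) by (metis exp_ln exp_of_real of_real_of_nat_eq)
    ultimately have "Q = exp (2 * s * ?L)"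
      unfolding Q_def by (simp add: s_def algebra_simps flip: exp_add)
    then have "Q ^ m = exp (of_nat m * (2 * s * ?L))"
      by (simp add: exp_of_nat_mult)
    moreover have expo: "s * of_int (horo_height adj v0 x \<omega>) = - s * of_nat n + of_nat m * (2 * s)"
      unfolding horo_height_eq[OF \<omega>] m_def n_def by (simp add: algebra_simps)
    ultimately show ?thesis
      unfolding poisson_power_def expo using q(1)
      by (simp add: powr_def L algebra_simps flip: exp_add)
  qed
  ultimately show ?thesis
    by (simp add: n_def)
qed

text \<open>
  The factor \<open>q powr (- s n)\<close> of the Poisson power, with \<open>n = level x\<close>, has modulus \<open>sqrt q ^ - n\<close>.
  This is \<open>ncyl x\<close> with that weight; on the cylinder of \<open>x\<close> it is comparable to \<open>sqrt q ^ n\<close>.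
\<close>

definition wcyl :: "'a \<Rightarrow> (nat \<Rightarrow> 'a) \<Rightarrow> real" where
  "wcyl x \<omega> = indicator (cyl x) \<omega> / (mass x * sqrt (real q) ^ level x)"

lemma wcyl_nonneg: "0 \<le> wcyl x \<omega>"
  using mass_bounds(1)[of x] by (auto simp: wcyl_def indicator_def)

lemma of_real_wcyl: "complex_of_real (wcyl x \<omega>) = of_real (1 / sqrt (real q) ^ level x) * ncyl x \<omega>"
  by (simp add: wcyl_def ncyl_def)

lemma wcyl_L2: "(\<lambda>\<omega>. complex_of_real (wcyl x \<omega>)) \<in> L2_space \<nu>"
  unfolding of_real_wcyl by (intro L2_space_scale ncyl_L2)

lemma sqrt_q: "1 < sqrt (real q)" "sqrt (real q) ^ n * sqrt (real q) ^ n = real q ^ n"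
  using q_ge_2 by (auto simp flip: power_mult_distrib)

lemma wcyl_bounds:
  assumes "\<omega> \<in> cyl x"
  shows "sqrt (real q) ^ level x \<le> wcyl x \<omega>" "wcyl x \<omega> \<le> 2 * sqrt (real q) ^ level x"
proof -
  let ?r = "sqrt (real q) ^ level x"
  have r: "0 < ?r"
    using sqrt_q(1) by simp
  have eq: "wcyl x \<omega> = (1 / mass x) / ?r"
    using assms by (simp add: wcyl_def)
  have "real q ^ level x / ?r \<le> (1 / mass x) / ?r" "(1 / mass x) / ?r \<le> 2 * real q ^ level x / ?r"
    using r by (intro divide_right_mono mass_bounds; simp)+
  moreover have "real q ^ level x / ?r = ?r" "2 * real q ^ level x / ?r = 2 * ?r"
    using r sqrt_q(2)[of "level x"] by (simp_all add: divide_eq_eq)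
  ultimately show "?r \<le> wcyl x \<omega>" "wcyl x \<omega> \<le> 2 * ?r"
    unfolding eq by simp_all
qed

text \<open>
  Twice the sum of the geometric series with ratio \<open>1 / sqrt q\<close>; the factor \<open>2\<close> is that between the
  two bounds for \<open>wcyl\<close> on its cylinder.
\<close>

definition geom_const :: real where
  "geom_const = 2 * sqrt (real q) / (sqrt (real q) - 1)"

lemma geom_const_pos: "0 < geom_const"
  using sqrt_q(1) by (simp add: geom_const_def)

text \<open>
  The vertices of \<open>E\<close> on one ray have distinct levels, and \<open>wcyl\<close> grows geometrically along the ray.
  The sum is therefore controlled by the term of the deepest vertex alone, and its square by the
  square of that term.
\<close>

lemma sum_wcyl_square_le:
  assumes "finite E"
  shows "(\<Sum>x\<in>E. wcyl x \<omega>)\<^sup>2 \<le> geom_const\<^sup>2 * (\<Sum>x\<in>E. (wcyl x \<omega>)\<^sup>2)"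
proof -
  let ?r = "sqrt (real q)"
  define J where "J = {x \<in> E. \<omega> \<in> cyl x}"
  have J: "finite J" "J \<subseteq> E"
    using assms by (auto simp: J_def)
  have zero: "wcyl x \<omega> = 0" if "x \<in> E - J" for x
    using that by (simp add: J_def wcyl_def)
  have sumJ: "(\<Sum>x\<in>E. wcyl x \<omega>) = (\<Sum>x\<in>J. wcyl x \<omega>)"
    using zero by (intro sum.mono_neutral_right assms J) auto
  show ?thesis
  proof (cases "J = {}")
    case True
    then show ?thesis
      unfolding sumJ by (simp add: sum_nonneg)
  next
    case False
    define N where "N = Max (level ` J)"
    have "N \<in> level ` J"
      unfolding N_def using J(1) False by (intro Max_in) auto
    then obtain y where y: "y \<in> J" "level y = N"
      by auto
    have le_N: "level x \<le> N" if "x \<in> J" for x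
      unfolding N_def using J(1) that by (intro Max_ge) auto
    have inj: "inj_on level J"
      by (rule inj_onI) (auto simp: J_def boundary_cyl_def)
    have "(\<Sum>x\<in>J. wcyl x \<omega>) \<le> (\<Sum>x\<in>J. 2 * ?r ^ level x)"
      by (intro sum_mono wcyl_bounds) (simp add: J_def)
    also have "\<dots> = 2 * (\<Sum>k\<in>level ` J. ?r ^ k)"
      using inj by (simp add: sum.reindex sum_distrib_left)
    also have "\<dots> \<le> 2 * (\<Sum>k\<in>{..N}. ?r ^ k)"
      using le_N by (intro mult_left_mono sum_mono2) auto
    also have "(\<Sum>k\<in>{..N}. ?r ^ k) = (?r ^ Suc N - 1) / (?r - 1)"
      using sqrt_q(1) geometric_sum[of ?r "Suc N"] by (simp add: lessThan_Suc_atMost)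
    also have "2 * \<dots> \<le> 2 * (?r ^ Suc N / (?r - 1))"
      using sqrt_q(1) by (intro mult_left_mono divide_right_mono) auto
    also have "\<dots> = geom_const * ?r ^ N"
      by (simp add: geom_const_def)
    also have "\<dots> \<le> geom_const * wcyl y \<omega>"
      using wcyl_bounds(1)[of \<omega> y] y geom_const_pos by (intro mult_left_mono) (auto simp: J_def)
    finally have "(\<Sum>x\<in>E. wcyl x \<omega>) \<le> geom_const * wcyl y \<omega>"
      unfolding sumJ .
    then have "(\<Sum>x\<in>E. wcyl x \<omega>)\<^sup>2 \<le> (geom_const * wcyl y \<omega>)\<^sup>2"
      by (intro power_mono sum_nonneg wcyl_nonneg)
    also have "\<dots> \<le> geom_const\<^sup>2 * (\<Sum>x\<in>E. (wcyl x \<omega>)\<^sup>2)"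
      unfolding power_mult_distrib
      using y(1) J(2) assms by (intro mult_left_mono member_le_sum) auto
    finally show ?thesis .
  qed
qed

definition restr_const :: real where
  "restr_const = geom_const * sqrt 2"

lemma restr_const_pos: "0 < restr_const"
  using geom_const_pos by (simp add: restr_const_def)

text \<open>
  The restriction estimate for the indicator of \<open>E\<close>: the square of the sum is controlled by the sum
  of the squares, each of which has integral at most \<open>2\<close>.
\<close>

lemma L2_norm_sum_wcyl_le:
  assumes "finite E"
  shows "L2_norm \<nu> (\<lambda>\<omega>. of_real (\<Sum>x\<in>E. wcyl x \<omega>)) \<le> restr_const * sqrt (card E)"
proof -
  have mem: "(\<lambda>\<omega>. complex_of_real (\<Sum>x\<in>E. wcyl x \<omega>)) \<in> L2_space \<nu>"
    unfolding of_real_sum by (intro L2_space_sum wcyl_L2)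
  have int: "integrable \<nu> (\<lambda>\<omega>. (wcyl x \<omega>)\<^sup>2)" for x
    using L2_space_integrable_norm[OF wcyl_L2] by simp
  have "(\<integral>\<omega>. (wcyl x \<omega>)\<^sup>2 \<partial>\<nu>) \<le> 2" for x
  proof -
    have "(wcyl x \<omega>)\<^sup>2 = indicator (cyl x) \<omega> /
        ((mass x)\<^sup>2 * (sqrt (real q) ^ level x * sqrt (real q) ^ level x))" for \<omega>
      by (simp add: wcyl_def power2_eq_square indicator_def mult_ac)
    then have "(wcyl x \<omega>)\<^sup>2 = indicator (cyl x) \<omega> / ((mass x)\<^sup>2 * real q ^ level x)" for \<omega>
      unfolding sqrt_q(2) .
    then have "(\<integral>\<omega>. (wcyl x \<omega>)\<^sup>2 \<partial>\<nu>) = mass x / ((mass x)\<^sup>2 * real q ^ level x)"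
      by (simp add: mass_def)
    also have "\<dots> = (1 / mass x) / real q ^ level x"
      using mass_bounds(1)[of x] by (simp add: power2_eq_square)
    also have "\<dots> \<le> 2 * real q ^ level x / real q ^ level x"
      by (intro divide_right_mono mass_bounds) simp
    also have "\<dots> = 2"
      using q_ge_2 by simp
    finally show ?thesis .
  qed
  then have sum2: "(\<Sum>x\<in>E. \<integral>\<omega>. (wcyl x \<omega>)\<^sup>2 \<partial>\<nu>) \<le> (\<Sum>x\<in>E. 2)"
    by (intro sum_mono)
  have "(L2_norm \<nu> (\<lambda>\<omega>. of_real (\<Sum>x\<in>E. wcyl x \<omega>)))\<^sup>2 = (\<integral>\<omega>. (\<Sum>x\<in>E. wcyl x \<omega>)\<^sup>2 \<partial>\<nu>)"
    by (simp only: L2_norm_squared norm_of_real power2_abs)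
  also have "\<dots> \<le> (\<integral>\<omega>. geom_const\<^sup>2 * (\<Sum>x\<in>E. (wcyl x \<omega>)\<^sup>2) \<partial>\<nu>)"
    using L2_space_integrable_norm[OF mem] int
    by (intro integral_mono sum_wcyl_square_le assms)
       (auto simp only: norm_of_real power2_abs intro!: integrable_mult_right Bochner_Integration.integrable_sum)
  also have "\<dots> = geom_const\<^sup>2 * (\<Sum>x\<in>E. \<integral>\<omega>. (wcyl x \<omega>)\<^sup>2 \<partial>\<nu>)"
    using int by simp
  also have "\<dots> \<le> geom_const\<^sup>2 * (2 * card E)"
    using sum2 by (intro mult_left_mono) (simp_all add: mult.commute)
  also have "\<dots> = (restr_const * sqrt (card E))\<^sup>2"
    by (simp add: restr_const_def power_mult_distrib)
  finally show ?thesis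
    by (rule power2_le_imp_le) (use restr_const_pos in simp)
qed

text \<open>
  From sets to functions. With \<open>V\<close> the function on the left, the square of its norm is the sum of
  \<open>\<bar>f x\<bar>\<close> times the inner product of \<open>V\<close> and \<open>wcyl x\<close>. Slice \<open>\<bar>f\<bar>\<close> into its superlevel sets, apply
  the Cauchy-Schwarz inequality and the estimate for sets to each slice, and integrate: the outcome
  is the norm of \<open>V\<close> times the layer-cake form of the Lorentz norm.
\<close>

lemma L2_norm_weighted_wcyl_le:
  assumes fin: "finite {x. f x \<noteq> 0}"
  shows "ennreal (L2_norm \<nu> (\<lambda>\<omega>. of_real (\<Sum>x | f x \<noteq> 0. cmod (f x) * wcyl x \<omega>)))
    \<le> ennreal restr_const * lorentz21_norm f"
proof -
  let ?S = "{x. f x \<noteq> 0}"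
  define V where "V \<omega> = (\<Sum>x\<in>?S. cmod (f x) * wcyl x \<omega>)" for \<omega>
  let ?V = "\<lambda>\<omega>. complex_of_real (V \<omega>)"
  have V0: "0 \<le> V \<omega>" for \<omega>
    unfolding V_def by (intro sum_nonneg mult_nonneg_nonneg wcyl_nonneg) auto
  have mem: "?V \<in> L2_space \<nu>"
    unfolding V_def of_real_sum of_real_mult by (intro L2_space_sum L2_space_scale wcyl_L2)
  have int: "integrable \<nu> (\<lambda>\<omega>. V \<omega> * wcyl x \<omega>)" for x
    using L2_space_integrable_mult(2)[OF mem wcyl_L2[of x]] V0 wcyl_nonneg by simp
  define \<beta> where "\<beta> x = (\<integral>\<omega>. V \<omega> * wcyl x \<omega> \<partial>\<nu>)" for x
  have \<beta>0: "0 \<le> \<beta> x" for x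
    unfolding \<beta>_def by (intro Bochner_Integration.integral_nonneg mult_nonneg_nonneg V0 wcyl_nonneg)
  have \<beta>: "(\<Sum>x\<in>E. \<beta> x) \<le> L2_norm \<nu> ?V * restr_const * sqrt (card E)" if "finite E" for E
  proof -
    have memE: "(\<lambda>\<omega>. complex_of_real (\<Sum>x\<in>E. wcyl x \<omega>)) \<in> L2_space \<nu>"
      unfolding of_real_sum by (intro L2_space_sum wcyl_L2)
    have "(\<Sum>x\<in>E. \<beta> x) = (\<integral>\<omega>. cmod (?V \<omega>) * cmod (of_real (\<Sum>x\<in>E. wcyl x \<omega>)) \<partial>\<nu>)"
      unfolding \<beta>_def norm_of_real using int V0 wcyl_nonneg
      by (simp add: sum_nonneg sum_distrib_left Bochner_Integration.integral_sum)
    also have "\<dots> \<le> L2_norm \<nu> ?V * L2_norm \<nu> (\<lambda>\<omega>. of_real (\<Sum>x\<in>E. wcyl x \<omega>))"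
      by (rule L2_Cauchy_Schwarz[OF mem memE])
    also have "\<dots> \<le> L2_norm \<nu> ?V * (restr_const * sqrt (card E))"
      by (intro mult_left_mono L2_norm_sum_wcyl_le that) simp
    finally show ?thesis
      by (simp add: mult.assoc)
  qed
  have "(L2_norm \<nu> ?V)\<^sup>2 = (\<integral>\<omega>. (\<Sum>x\<in>?S. cmod (f x) * (V \<omega> * wcyl x \<omega>)) \<partial>\<nu>)"
    unfolding L2_norm_squared norm_of_real power2_abs
    by (subst power2_eq_square, subst (2) V_def) (simp add: sum_distrib_left mult_ac)
  also have "\<dots> = (\<Sum>x\<in>?S. cmod (f x) * \<beta> x)"
    using int by (simp add: \<beta>_def Bochner_Integration.integral_sum)
  finally have "ennreal ((L2_norm \<nu> ?V)\<^sup>2) = (\<Sum>x\<in>?S. ennreal (\<beta> x) * ennreal (cmod (f x)))"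
    using \<beta>0 by (simp add: sum_ennreal[symmetric] ennreal_mult mult.commute)
  also have "\<dots> = (\<Sum>x\<in>?S. \<integral>\<^sup>+s. ennreal (\<beta> x) * indicator {0<..<cmod (f x)} s \<partial>lborel)"
    by (simp add: nn_integral_cmult)
  also have "\<dots> = (\<integral>\<^sup>+s. (\<Sum>x\<in>?S. ennreal (\<beta> x) * indicator {0<..<cmod (f x)} s) \<partial>lborel)"
    by (rule nn_integral_sum[symmetric]) simp
  also have "\<dots> \<le> (\<integral>\<^sup>+s. ennreal (L2_norm \<nu> ?V * restr_const) *
      (ennreal (sqrt (card {x. s < cmod (f x)})) * indicator {0<..} s) \<partial>lborel)"
  proof (rule nn_integral_mono)
    fix s :: real
    let ?E = "{x. s < cmod (f x)}"
    show "(\<Sum>x\<in>?S. ennreal (\<beta> x) * indicator {0<..<cmod (f x)} s)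
        \<le> ennreal (L2_norm \<nu> ?V * restr_const) * (ennreal (sqrt (card ?E)) * indicator {0<..} s)"
    proof (cases "0 < s")
      case True
      have E: "?E \<subseteq> ?S"
        using True by auto
      then have finE: "finite ?E"
        using fin finite_subset by blast
      have "(\<Sum>x\<in>?S. ennreal (\<beta> x) * indicator {0<..<cmod (f x)} s) = (\<Sum>x\<in>?E. ennreal (\<beta> x))"
        using E fin True by (intro sum.mono_neutral_cong_right) (auto simp: indicator_def)
      also have "\<dots> = ennreal (\<Sum>x\<in>?E. \<beta> x)"
        using \<beta>0 by simp
      also have "\<dots> \<le> ennreal (L2_norm \<nu> ?V * restr_const * sqrt (card ?E))"
        by (intro ennreal_leI \<beta> finE)
      also have "\<dots> = ennreal (L2_norm \<nu> ?V * restr_const) * (ennreal (sqrt (card ?E)) * indicator {0<..} s)"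
        using True restr_const_pos by (simp add: ennreal_mult)
      finally show ?thesis .
    qed (simp add: indicator_def)
  qed
  also have "\<dots> \<le> ennreal (L2_norm \<nu> ?V * restr_const) *
      (\<integral>\<^sup>+s\<in>{0<..}. ennreal (sqrt (card {x. s < cmod (f x)})) \<partial>lborel)"
    by (simp add: nn_integral_cmult[OF layer_measurable[OF fin]])
  also have "\<dots> \<le> ennreal (L2_norm \<nu> ?V * restr_const) * lorentz21_norm f"
    by (intro mult_left_mono layer_cake_le_lorentz21_norm fin) simp
  finally have main: "ennreal ((L2_norm \<nu> ?V)\<^sup>2) \<le> ennreal (L2_norm \<nu> ?V * restr_const) * lorentz21_norm f" .
  have "ennreal (L2_norm \<nu> ?V) \<le> ennreal restr_const * lorentz21_norm f"
  proof (cases "lorentz21_norm f" rule: ennreal_cases)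
    case (real l)
    have "(L2_norm \<nu> ?V)\<^sup>2 \<le> L2_norm \<nu> ?V * restr_const * l"
      using main real restr_const_pos by (simp add: ennreal_mult[symmetric])
    then have "L2_norm \<nu> ?V \<le> restr_const * l"
      using L2_norm_nonneg[of \<nu> ?V] real restr_const_pos
      by (cases "L2_norm \<nu> ?V = 0") (auto simp: power2_eq_square mult.assoc)
    then show ?thesis
      using real restr_const_pos by (simp add: ennreal_mult[symmetric])
  next
    case top
    then show ?thesis
      using restr_const_pos by (simp add: ennreal_mult_top)
  qed
  then show ?thesis
    by (simp add: V_def)
qed

end

section \<open>The inequality for finitely supported functions\<close>

context tree_boundary
begin

text \<open>
  By nonnegativity of the functions \<open>ncyl x\<close>, a combination of them is dominated pointwise by the one
  with the moduli of the coefficients. As each \<open>ncyl x\<close> has integral \<open>1\<close>, the sum of the coefficients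
  is the integral of the combination, so that on a probability space it obeys the same bound.
\<close>

lemma
  fixes f :: "'a \<Rightarrow> complex" and b :: "'a \<Rightarrow> complex"
  assumes fin: "finite {x. f x \<noteq> 0}"
    and b: "\<And>x. cmod (b x) = cmod (f x) / sqrt (real q) ^ level x"
  defines "V \<equiv> \<lambda>\<omega>. complex_of_real (\<Sum>x | f x \<noteq> 0. cmod (f x) * wcyl x \<omega>)"
  shows L2_norm_sum_ncyl_le: "L2_norm \<nu> (\<lambda>\<omega>. \<Sum>x | f x \<noteq> 0. b x * ncyl x \<omega>) \<le> L2_norm \<nu> V"
    and norm_sum_le_L2_norm: "cmod (\<Sum>x | f x \<noteq> 0. b x) \<le> L2_norm \<nu> V"
proof -
  have eq: "cmod (b x * ncyl x \<omega>) = cmod (f x) * wcyl x \<omega>" for x \<omega>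
    using mass_bounds(1)[of x] by (simp add: norm_mult b ncyl_def wcyl_def norm_divide indicator_def)
  have memV: "V \<in> L2_space \<nu>"
    unfolding V_def of_real_sum of_real_mult by (intro L2_space_sum L2_space_scale wcyl_L2)
  have mem: "(\<lambda>\<omega>. \<Sum>x | f x \<noteq> 0. b x * ncyl x \<omega>) \<in> L2_space \<nu>"
    by (intro L2_space_sum L2_space_scale ncyl_L2)
  have le: "cmod (\<Sum>x | f x \<noteq> 0. b x * ncyl x \<omega>) \<le> cmod (V \<omega>)" for \<omega>
  proof -
    have "cmod (\<Sum>x | f x \<noteq> 0. b x * ncyl x \<omega>) \<le> (\<Sum>x | f x \<noteq> 0. cmod (f x) * wcyl x \<omega>)"
      unfolding eq[symmetric] by (rule norm_sum)
    also have "\<dots> \<le> cmod (V \<omega>)"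
      unfolding V_def norm_of_real by (rule abs_ge_self)
    finally show ?thesis .
  qed
  show "L2_norm \<nu> (\<lambda>\<omega>. \<Sum>x | f x \<noteq> 0. b x * ncyl x \<omega>) \<le> L2_norm \<nu> V"
    by (rule L2_space_bound(2)[OF L2_spaceD[OF mem] memV le])
  have one: "(\<lambda>_. 1) \<in> L2_space \<nu>" "L2_norm \<nu> (\<lambda>_. 1) = 1"
    by (simp_all add: L2_space_def L2_norm_def prob_space)
  have "(\<Sum>x | f x \<noteq> 0. b x) = (\<integral>\<omega>. (\<Sum>x | f x \<noteq> 0. b x * ncyl x \<omega>) \<partial>\<nu>)"
  proof -
    have "integrable \<nu> (ncyl x)" for x
      using L2_space_integrable_mult(1)[OF ncyl_L2 one(1)] by simp
    then show ?thesis
      by (simp add: Bochner_Integration.integral_sum integral_ncyl)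
  qed
  also have "cmod \<dots> \<le> (\<integral>\<omega>. cmod (\<Sum>x | f x \<noteq> 0. b x * ncyl x \<omega>) \<partial>\<nu>)"
    by (rule integral_norm_bound)
  also have "\<dots> \<le> (\<integral>\<omega>. cmod (V \<omega>) * cmod 1 \<partial>\<nu>)"
    using L2_space_integrable_mult(2)[OF mem one(1)] L2_space_integrable_mult(2)[OF memV one(1)] le
    by (intro integral_mono) simp_all
  also have "\<dots> \<le> L2_norm \<nu> V"
    using L2_Cauchy_Schwarz[OF memV one(1)] one(2) by simp
  finally show "cmod (\<Sum>x | f x \<noteq> 0. b x) \<le> L2_norm \<nu> V" .
qed

text \<open>
  By \<open>poisson_power_expansion\<close>, the transform is a constant function plus a combination of the
  \<open>ncyl x\<close> plus the rotation of another such combination. The rotation being isometric, all three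
  parts have norm at most a constant times that of the positive sum of the \<open>cmod (f x) * wcyl x\<close>.
\<close>

theorem restriction_finite_support:
  fixes z :: real
  assumes w: "cis (2 * z * ln (real q)) \<noteq> 1"
  shows "\<exists>C>0. \<forall>f. finite {x. f x \<noteq> 0} \<longrightarrow>
    helgason_fourier adj q v0 (of_real z) f \<in> L2_space \<nu> \<and>
    ennreal (L2_norm \<nu> (helgason_fourier adj q v0 (of_real z) f)) \<le> ennreal C * lorentz21_norm f"
proof -
  define w where "w = cis (2 * z * ln (real q))"
  define s where "s = 1/2 + \<i> * complex_of_real z"
  define c where "c = (1 - 1 / (of_nat q * w)) * (of_nat q / (of_nat q + 1))"
  define c1 where "c1 = c * (1 - 1 / (1 - w))"
  define c2 where "c2 = c / (1 - w)"
  define K where "K = cmod (1 - c) + cmod c1 + cmod c2"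
  have K: "0 \<le> K"
    by (simp add: K_def)
  \<comment> \<open>\<open>K + 1\<close> instead of \<open>K\<close> makes positivity of the constant evident.\<close>
  have "helgason_fourier adj q v0 (of_real z) f \<in> L2_space \<nu> \<and>
      ennreal (L2_norm \<nu> (helgason_fourier adj q v0 (of_real z) f))
        \<le> ennreal ((K + 1) * restr_const) * lorentz21_norm f"
    if fin: "finite {x. f x \<noteq> 0}" for f :: "'a \<Rightarrow> complex"
  proof -
    let ?S = "{x. f x \<noteq> 0}"
    define a where "a x = f x * of_nat q powr (- s * of_nat (level x))" for x
    define b where "b x = a x * w ^ level x" for x
    let ?V = "\<lambda>\<omega>. complex_of_real (\<Sum>x\<in>?S. cmod (f x) * wcyl x \<omega>)"
    have a: "cmod (a x) = cmod (f x) / sqrt (real q) ^ level x" for x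
    proof -
      have "cmod (of_nat q powr (- s * of_nat (level x))) = real q powr (- (1/2) * real (level x))"
        using q_ge_2 by (subst norm_powr_real_powr) (auto simp: s_def)
      also have "\<dots> = inverse ((real q powr (1/2)) powr real (level x))"
        by (simp add: powr_powr flip: powr_minus)
      also have "\<dots> = inverse (sqrt (real q) ^ level x)"
        using q_ge_2 sqrt_q(1) by (simp add: powr_half_sqrt powr_realpow)
      finally show ?thesis
        by (simp add: a_def norm_mult divide_inverse)
    qed
    have cmod_w: "cmod w = 1"
      by (simp add: w_def)
    have b: "cmod (b x) = cmod (f x) / sqrt (real q) ^ level x" for x
      by (simp add: b_def norm_mult norm_power cmod_w a)
    define H0 where "H0 \<omega> = (1 - c) * (\<Sum>x\<in>?S. a x)" for \<omega> :: "nat \<Rightarrow> 'a"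
    define H1 where "H1 \<omega> = c1 * (\<Sum>x\<in>?S. b x * ncyl x \<omega>)" for \<omega>
    define H2 where "H2 \<omega> = c2 * (\<Sum>x\<in>?S. a x * rotated w x \<omega>)" for \<omega>
    have H0: "H0 \<in> L2_space \<nu>"
      unfolding H0_def by (simp add: L2_space_def)
    have H1: "H1 \<in> L2_space \<nu>"
      unfolding H1_def by (intro L2_space_scale L2_space_sum ncyl_L2)
    have H2: "H2 \<in> L2_space \<nu>"
      unfolding H2_def by (intro L2_space_scale L2_space_sum rotated_L2)
    have H01: "(\<lambda>\<omega>. H0 \<omega> + H1 \<omega>) \<in> L2_space \<nu>"
      by (rule L2_space_add(1)[OF H0 H1])
    have eq: "helgason_fourier adj q v0 (of_real z) f \<omega> = H0 \<omega> + H1 \<omega> + H2 \<omega>" if "\<omega> \<in> space \<nu>" for \<omega>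
    proof -
      have "\<omega> \<in> boundary adj v0"
        using that by (simp add: space_\<nu>)
      then have expansion: "poisson_power adj q v0 s x \<omega> = of_nat q powr (- s * of_nat (level x)) *
          ((1 - c) + c1 * (w ^ level x * ncyl x \<omega>) + c2 * rotated w x \<omega>)" for x
        unfolding c1_def c2_def c_def s_def w_def by (rule poisson_power_expansion) (rule w)
      have "f x * poisson_power adj q v0 s x \<omega>
          = (1 - c) * a x + c1 * (b x * ncyl x \<omega>) + c2 * (a x * rotated w x \<omega>)" for x
        unfolding expansion a_def b_def by (simp add: algebra_simps)
      then show ?thesis
        unfolding helgason_fourier_def s_def[symmetric] H0_def H1_def H2_def
        by (simp add: sum.distrib sum_distrib_left)
    qed
    have mem: "helgason_fourier adj q v0 (of_real z) f \<in> L2_space \<nu>"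
      by (rule iffD2[OF L2_space_cong L2_space_add(1)[OF H01 H2]]) (rule eq)
    have "L2_norm \<nu> (helgason_fourier adj q v0 (of_real z) f) = L2_norm \<nu> (\<lambda>\<omega>. H0 \<omega> + H1 \<omega> + H2 \<omega>)"
      by (rule L2_norm_cong[OF eq])
    also have "\<dots> \<le> L2_norm \<nu> H0 + L2_norm \<nu> H1 + L2_norm \<nu> H2"
      using L2_norm_triangle[OF H01 H2] L2_norm_triangle[OF H0 H1] by linarith
    also have "L2_norm \<nu> H0 = cmod (1 - c) * cmod (\<Sum>x\<in>?S. a x)"
      unfolding H0_def by (simp add: L2_norm_def norm_mult prob_space)
    also have "L2_norm \<nu> H1 = cmod c1 * L2_norm \<nu> (\<lambda>\<omega>. \<Sum>x\<in>?S. b x * ncyl x \<omega>)"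
      unfolding H1_def by (rule L2_norm_scale)
    also have "L2_norm \<nu> H2 = cmod c2 * L2_norm \<nu> (\<lambda>\<omega>. \<Sum>x\<in>?S. a x * ncyl x \<omega>)"
      unfolding H2_def L2_norm_scale rotated_isometry[OF fin cmod_w] ..
    also have "cmod (1 - c) * cmod (\<Sum>x\<in>?S. a x) + cmod c1 * L2_norm \<nu> (\<lambda>\<omega>. \<Sum>x\<in>?S. b x * ncyl x \<omega>)
        + cmod c2 * L2_norm \<nu> (\<lambda>\<omega>. \<Sum>x\<in>?S. a x * ncyl x \<omega>)
      \<le> cmod (1 - c) * L2_norm \<nu> ?V + cmod c1 * L2_norm \<nu> ?V + cmod c2 * L2_norm \<nu> ?V"
      by (intro add_mono mult_left_mono norm_sum_le_L2_norm L2_norm_sum_ncyl_le fin a b) auto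
    also have "\<dots> \<le> (K + 1) * L2_norm \<nu> ?V"
      by (simp add: K_def algebra_simps)
    finally have "ennreal (L2_norm \<nu> (helgason_fourier adj q v0 (of_real z) f))
        \<le> ennreal ((K + 1) * L2_norm \<nu> ?V)"
      by (rule ennreal_leI)
    also have "\<dots> = ennreal (K + 1) * ennreal (L2_norm \<nu> ?V)"
      using K by (intro ennreal_mult) auto
    also have "\<dots> \<le> ennreal (K + 1) * (ennreal restr_const * lorentz21_norm f)"
      by (intro mult_left_mono L2_norm_weighted_wcyl_le fin) simp
    also have "\<dots> = ennreal ((K + 1) * restr_const) * lorentz21_norm f"
      using K restr_const_pos by (simp add: ennreal_mult mult.assoc)
    finally show ?thesis
      using mem by blast
  qed
  moreover have "0 < (K + 1) * restr_const"
    using K restr_const_pos by simp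
  ultimately show ?thesis
    by blast
qed

end

section \<open>Extension to the Lorentz space\<close>

context tree_boundary
begin

definition trunc :: "nat \<Rightarrow> ('a \<Rightarrow> complex) \<Rightarrow> 'a \<Rightarrow> complex" where
  "trunc k f x = (if level x \<le> k then f x else 0)"

lemma trunc_support: "finite {x. trunc k f x \<noteq> 0}"
  by (rule finite_subset[OF _ finite_ball[of k]]) (auto simp: trunc_def)

lemma lorentz21_norm_trunc_le: "lorentz21_norm (trunc k f) \<le> lorentz21_norm f"
  by (rule lorentz21_norm_mono) (simp add: trunc_def)

lemma trunc_lorentz21: "f \<in> lorentz21 \<Longrightarrow> trunc k f \<in> lorentz21"
  using lorentz21_norm_trunc_le[of k f] by (auto simp: lorentz21_def)

lemma trunc_tendsto:
  assumes "f \<in> lorentz21"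
  shows "(\<lambda>k. lorentz21_norm (\<lambda>x. if level x \<le> k then 0 else f x)) \<longlonglongrightarrow> 0"
  using lorentz21_tail[OF assms, of "\<lambda>k. {x. level x \<le> k}"] by auto

lemma helgason_fourier_diff:
  assumes "finite {x. f x \<noteq> 0}" "finite {x. g x \<noteq> 0}"
  shows "helgason_fourier adj q v0 z (\<lambda>x. f x - g x) \<omega>
    = helgason_fourier adj q v0 z f \<omega> - helgason_fourier adj q v0 z g \<omega>"
proof -
  let ?S = "{x. f x \<noteq> 0} \<union> {x. g x \<noteq> 0}"
  have S: "helgason_fourier adj q v0 z h \<omega>
      = (\<Sum>x\<in>?S. h x * poisson_power adj q v0 (1/2 + \<i> * z) x \<omega>)" if "{x. h x \<noteq> 0} \<subseteq> ?S" for h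
    unfolding helgason_fourier_def using assms that by (intro sum.mono_neutral_left) auto
  show ?thesis
    by (subst (1 2 3) S) (auto simp: algebra_simps sum_subtractf)
qed

text \<open>
  The extension at \<open>f\<close> is the \<open>L\<^sup>2\<close> limit of the transforms of the truncations of \<open>f\<close> to balls. If two
  functions are truncated to the same ball, the truncations differ by at most \<open>\<bar>g x - f x\<bar>\<close> at each
  \<open>x\<close>. Monotonicity of the Lorentz norm thus bounds the difference of their transforms by the norm of
  \<open>g - f\<close>, uniformly in the ball, and the bound survives in the limit.
\<close>

lemma extension_exists:
  assumes bound: "\<And>f. finite {x. f x \<noteq> 0} \<Longrightarrow>
      helgason_fourier adj q v0 z f \<in> L2_space \<nu> \<and>
      ennreal (L2_norm \<nu> (helgason_fourier adj q v0 z f)) \<le> ennreal C * lorentz21_norm f"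
  shows "\<exists>T. helgason_fourier_extension adj q v0 \<nu> z T"
proof -
  let ?H = "helgason_fourier adj q v0 z"
  have mem: "?H (trunc k f) \<in> L2_space \<nu>" for k f
    using bound[OF trunc_support] by blast
  have memf: "?H f \<in> L2_space \<nu>" if "finite {x. f x \<noteq> 0}" for f
    using bound[OF that] by blast
  have diff_bound: "ennreal (L2_norm \<nu> (\<lambda>\<omega>. ?H f \<omega> - ?H g \<omega>)) \<le> ennreal C * lorentz21_norm h"
    if "finite {x. f x \<noteq> 0}" "finite {x. g x \<noteq> 0}" "\<And>x. cmod (f x - g x) \<le> cmod (h x)" for f g h
  proof -
    have "finite {x. f x - g x \<noteq> 0}"
      by (rule finite_subset[of _ "{x. f x \<noteq> 0} \<union> {x. g x \<noteq> 0}"]) (use that in auto)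
    then have "ennreal (L2_norm \<nu> (?H (\<lambda>x. f x - g x))) \<le> ennreal C * lorentz21_norm (\<lambda>x. f x - g x)"
      by (rule conjunct2[OF bound])
    also have "\<dots> \<le> ennreal C * lorentz21_norm h"
      by (intro mult_left_mono lorentz21_norm_mono that) simp
    also have "?H (\<lambda>x. f x - g x) = (\<lambda>\<omega>. ?H f \<omega> - ?H g \<omega>)"
      using helgason_fourier_diff[OF that(1,2)] by auto
    finally show ?thesis .
  qed
  define limit_of where "limit_of f G \<longleftrightarrow> G \<in> L2_space \<nu> \<and>
      (\<lambda>k. L2_norm \<nu> (\<lambda>\<omega>. G \<omega> - ?H (trunc k f) \<omega>)) \<longlonglongrightarrow> 0" for f G
  have ex: "\<exists>G. limit_of f G" if f: "f \<in> lorentz21" for f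
  proof -
    have "\<exists>N. \<forall>m\<ge>N. \<forall>n\<ge>N. L2_norm \<nu> (\<lambda>\<omega>. ?H (trunc m f) \<omega> - ?H (trunc n f) \<omega>) \<le> e" if "0 < e" for e
    proof -
      have "(\<lambda>k. ennreal C * lorentz21_norm (\<lambda>x. if level x \<le> k then 0 else f x)) \<longlonglongrightarrow> ennreal C * 0"
        by (intro tendsto_mult_ennreal tendsto_const trunc_tendsto f) simp
      then have "\<forall>\<^sub>F k in sequentially. ennreal C * lorentz21_norm (\<lambda>x. if level x \<le> k then 0 else f x) < ennreal e"
        by (rule order_tendstoD) (use that in simp)
      then obtain N where N: "ennreal C * lorentz21_norm (\<lambda>x. if level x \<le> N then 0 else f x) < ennreal e"
        by (auto simp: eventually_sequentially)
      have "L2_norm \<nu> (\<lambda>\<omega>. ?H (trunc m f) \<omega> - ?H (trunc n f) \<omega>) \<le> e" if "m \<ge> N" "n \<ge> N" for m n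
      proof -
        have "ennreal (L2_norm \<nu> (\<lambda>\<omega>. ?H (trunc m f) \<omega> - ?H (trunc n f) \<omega>)) \<le> ennreal e"
          by (rule order_trans[OF diff_bound[OF trunc_support trunc_support] less_imp_le[OF N]])
             (use that in \<open>auto simp: trunc_def\<close>)
        then show ?thesis
          using \<open>0 < e\<close> by simp
      qed
      then show ?thesis
        by blast
    qed
    from L2_complete[OF mem this] show ?thesis
      by (auto simp: limit_of_def)
  qed
  \<comment> \<open>For finitely supported \<open>f\<close> the truncations become stationary, so that the choice is determined
     up to null sets by the transform of \<open>f\<close> itself.\<close>
  define T where "T f = (SOME G. limit_of f G)" for f
  have T: "limit_of f (T f)" if "f \<in> lorentz21" for f
    unfolding T_def using ex[OF that] by (rule someI_ex)
  have T_fin: "AE \<omega> in \<nu>. T f \<omega> = ?H f \<omega>" if fin: "finite {x. f x \<noteq> 0}" for f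
  proof -
    obtain K where K: "level x \<le> K" if "f x \<noteq> 0" for x
      using finite_imageI[OF fin, of level] unfolding finite_nat_set_iff_bounded_le by auto
    have eq: "trunc k f = f" if "K \<le> k" for k
      using K that by (force simp: trunc_def)
    then have ev: "\<forall>\<^sub>F k in sequentially. L2_norm \<nu> (\<lambda>\<omega>. G \<omega> - ?H (trunc k f) \<omega>) = L2_norm \<nu> (\<lambda>\<omega>. G \<omega> - ?H f \<omega>)" for G
      by (auto simp: eventually_sequentially intro!: exI[of _ K])
    have lim: "limit_of f G \<longleftrightarrow> G \<in> L2_space \<nu> \<and> L2_norm \<nu> (\<lambda>\<omega>. G \<omega> - ?H f \<omega>) = 0" for G
      unfolding limit_of_def tendsto_cong[OF ev] by (simp add: tendsto_const_iff)
    have "limit_of f (?H f)"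
      unfolding lim using memf[OF fin] by (simp add: L2_norm_def)
    then have "limit_of f (T f)"
      unfolding T_def by (rule someI[of "limit_of f"])
    then have "AE \<omega> in \<nu>. T f \<omega> - ?H f \<omega> = 0"
      unfolding lim by (intro L2_norm_eq_0_AE L2_space_diff memf fin) auto
    then show ?thesis
      by simp
  qed
  have T_diff: "ennreal (L2_norm \<nu> (\<lambda>\<omega>. T g \<omega> - T f \<omega>)) \<le> ennreal C * lorentz21_norm (\<lambda>x. g x - f x)"
    if f: "f \<in> lorentz21" and g: "g \<in> lorentz21" for f g
  proof -
    have Tf: "T f \<in> L2_space \<nu>" and Tg: "T g \<in> L2_space \<nu>"
      using T f g by (auto simp: limit_of_def)
    let ?a = "\<lambda>k. L2_norm \<nu> (\<lambda>\<omega>. T g \<omega> - ?H (trunc k g) \<omega>) + L2_norm \<nu> (\<lambda>\<omega>. T f \<omega> - ?H (trunc k f) \<omega>)"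
    have a: "?a \<longlonglongrightarrow> 0 + 0"
      using T[OF f] T[OF g] by (intro tendsto_add) (auto simp: limit_of_def)
    have lim: "(\<lambda>k. ennreal (?a k) + ennreal C * lorentz21_norm (\<lambda>x. g x - f x))
        \<longlonglongrightarrow> ennreal C * lorentz21_norm (\<lambda>x. g x - f x)"
      using tendsto_add[OF tendsto_ennrealI[OF a]
          tendsto_const[of "ennreal C * lorentz21_norm (\<lambda>x. g x - f x)"]] by simp
    have "ennreal (L2_norm \<nu> (\<lambda>\<omega>. T g \<omega> - T f \<omega>)) \<le> ennreal (?a k) + ennreal C * lorentz21_norm (\<lambda>x. g x - f x)" for k
    proof -
      have "L2_norm \<nu> (\<lambda>\<omega>. T g \<omega> - T f \<omega>) \<le> L2_norm \<nu> (\<lambda>\<omega>. T g \<omega> - ?H (trunc k g) \<omega>)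
          + (L2_norm \<nu> (\<lambda>\<omega>. ?H (trunc k g) \<omega> - ?H (trunc k f) \<omega>)
          + L2_norm \<nu> (\<lambda>\<omega>. ?H (trunc k f) \<omega> - T f \<omega>))"
        using L2_norm_triangle_diff[OF Tg mem Tf, of k g]
          L2_norm_triangle_diff[OF mem mem Tf, of k g k f] by linarith
      also have "\<dots> = ?a k + L2_norm \<nu> (\<lambda>\<omega>. ?H (trunc k g) \<omega> - ?H (trunc k f) \<omega>)"
        using L2_norm_minus_commute[of \<nu> "T f" "?H (trunc k f)"] by simp
      finally have "ennreal (L2_norm \<nu> (\<lambda>\<omega>. T g \<omega> - T f \<omega>))
          \<le> ennreal (?a k) + ennreal (L2_norm \<nu> (\<lambda>\<omega>. ?H (trunc k g) \<omega> - ?H (trunc k f) \<omega>))"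
        by (simp add: ennreal_leI flip: ennreal_plus)
      also have "\<dots> \<le> ennreal (?a k) + ennreal C * lorentz21_norm (\<lambda>x. g x - f x)"
        by (intro add_left_mono diff_bound trunc_support) (simp add: trunc_def)
      finally show ?thesis .
    qed
    then show ?thesis
      by (intro tendsto_lowerbound[OF lim]) auto
  qed
  have "helgason_fourier_extension adj q v0 \<nu> z T"
    unfolding helgason_fourier_extension_def
  proof (intro conjI ballI allI impI)
    show "T f \<in> L2_space \<nu>" if "f \<in> lorentz21" for f
      using T[OF that] by (simp add: limit_of_def)
    show "AE \<omega> in \<nu>. T f \<omega> = ?H f \<omega>" if "finite {x. f x \<noteq> 0}" for f
      by (rule T_fin[OF that])
    fix f :: "'a \<Rightarrow> complex" and g :: "nat \<Rightarrow> 'a \<Rightarrow> complex"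
    assume f: "f \<in> lorentz21" and g: "\<forall>n. g n \<in> lorentz21"
      and lim: "(\<lambda>n. lorentz21_norm (\<lambda>x. g n x - f x)) \<longlonglongrightarrow> 0"
    have "(\<lambda>n. ennreal C * lorentz21_norm (\<lambda>x. g n x - f x)) \<longlonglongrightarrow> ennreal C * 0"
      by (intro tendsto_mult_ennreal tendsto_const lim) simp
    then have upper: "(\<lambda>n. ennreal C * lorentz21_norm (\<lambda>x. g n x - f x)) \<longlonglongrightarrow> 0"
      by simp
    have "\<forall>\<^sub>F n in sequentially. ennreal (L2_norm \<nu> (\<lambda>\<omega>. T (g n) \<omega> - T f \<omega>))
        \<le> ennreal C * lorentz21_norm (\<lambda>x. g n x - f x)"
      by (rule always_eventually) (use T_diff f g in blast)
    from tendsto_sandwich[OF _ this tendsto_const upper]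
    show "(\<lambda>n. L2_norm \<nu> (\<lambda>\<omega>. T (g n) \<omega> - T f \<omega>)) \<longlonglongrightarrow> 0"
      by (subst tendsto_ennreal_iff[symmetric]) simp_all
  qed
  then show ?thesis
    by blast
qed

lemma extension_bounded:
  assumes bound: "\<And>f. finite {x. f x \<noteq> 0} \<Longrightarrow>
      helgason_fourier adj q v0 z f \<in> L2_space \<nu> \<and>
      ennreal (L2_norm \<nu> (helgason_fourier adj q v0 z f)) \<le> ennreal C * lorentz21_norm f"
    and T: "helgason_fourier_extension adj q v0 \<nu> z T" and f: "f \<in> lorentz21"
  shows "ennreal (L2_norm \<nu> (T f)) \<le> ennreal C * lorentz21_norm f"
proof -
  let ?H = "helgason_fourier adj q v0 z"
  have mem: "T g \<in> L2_space \<nu>" if "g \<in> lorentz21" for g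
    using T that by (simp add: helgason_fourier_extension_def)
  have "(\<lambda>x. trunc k f x - f x) = (\<lambda>x. - (if level x \<le> k then 0 else f x))" for k
    by (auto simp: trunc_def)
  moreover have "lorentz21_norm (\<lambda>x. - h x) = lorentz21_norm h" for h :: "'a \<Rightarrow> complex"
    by (intro antisym lorentz21_norm_mono) auto
  ultimately have "(\<lambda>k. lorentz21_norm (\<lambda>x. trunc k f x - f x)) \<longlonglongrightarrow> 0"
    using trunc_tendsto[OF f] by simp
  then have "(\<lambda>k. L2_norm \<nu> (\<lambda>\<omega>. T (trunc k f) \<omega> - T f \<omega>)) \<longlonglongrightarrow> 0"
    using T f trunc_lorentz21[OF f] unfolding helgason_fourier_extension_def
    by (elim conjE ballE[of _ _ f] allE[of _ "\<lambda>k. trunc k f"]) auto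
  then have "(\<lambda>k. ennreal (L2_norm \<nu> (\<lambda>\<omega>. T (trunc k f) \<omega> - T f \<omega>)) + ennreal C * lorentz21_norm f)
      \<longlonglongrightarrow> ennreal 0 + ennreal C * lorentz21_norm f"
    by (intro tendsto_add tendsto_ennrealI tendsto_const)
  then have lim: "(\<lambda>k. ennreal (L2_norm \<nu> (\<lambda>\<omega>. T (trunc k f) \<omega> - T f \<omega>)) + ennreal C * lorentz21_norm f)
      \<longlonglongrightarrow> ennreal C * lorentz21_norm f"
    by simp
  have "ennreal (L2_norm \<nu> (T f))
      \<le> ennreal (L2_norm \<nu> (\<lambda>\<omega>. T (trunc k f) \<omega> - T f \<omega>)) + ennreal C * lorentz21_norm f" for k
  proof -
    have Tk: "T (trunc k f) \<in> L2_space \<nu>"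
      using mem trunc_lorentz21[OF f] by blast
    have "L2_norm \<nu> (T f) \<le> L2_norm \<nu> (\<lambda>\<omega>. T f \<omega> - T (trunc k f) \<omega>) + L2_norm \<nu> (T (trunc k f))"
      using L2_norm_triangle[OF L2_space_diff[OF mem[OF f] Tk] Tk] by simp
    moreover have "L2_norm \<nu> (T (trunc k f)) = L2_norm \<nu> (?H (trunc k f))"
      using T trunc_support[of k f] bound[OF trunc_support, of k f] Tk
      unfolding helgason_fourier_extension_def by (intro L2_norm_cong_AE) (auto dest: L2_spaceD)
    ultimately have "ennreal (L2_norm \<nu> (T f))
        \<le> ennreal (L2_norm \<nu> (\<lambda>\<omega>. T (trunc k f) \<omega> - T f \<omega>)) + ennreal (L2_norm \<nu> (?H (trunc k f)))"
      using L2_norm_minus_commute[of \<nu> "T f" "T (trunc k f)"]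
      by (simp add: ennreal_leI flip: ennreal_plus)
    also have "ennreal (L2_norm \<nu> (?H (trunc k f))) \<le> ennreal C * lorentz21_norm (trunc k f)"
      using bound[OF trunc_support] by blast
    also have "\<dots> \<le> ennreal C * lorentz21_norm f"
      by (intro mult_left_mono lorentz21_norm_trunc_le) simp
    finally show ?thesis
      by (simp add: add_left_mono)
  qed
  then show "ennreal (L2_norm \<nu> (T f)) \<le> ennreal C * lorentz21_norm f"
    by (intro tendsto_lowerbound[OF lim]) auto
qed

end

text \<open>
  The excluded frequencies are those at which \<open>q powr (2 \<i> z) = 1\<close>.
\<close>

lemma cis_ne_1:
  fixes q :: nat and z \<tau> :: real
  assumes "2 \<le> q" "\<tau> = 2 * pi / ln (real q)" "z \<notin> {\<tau> / 2 * of_int k | k :: int. True}"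
  shows "cis (2 * z * ln (real q)) \<noteq> 1"
proof
  assume "cis (2 * z * ln (real q)) = 1"
  then obtain n :: int where "2 * z * ln (real q) = of_int (2 * n) * pi"
    by (auto simp: cis_conv_exp exp_eq_1)
  moreover have "ln (real q) \<noteq> 0"
    using assms(1) by simp
  ultimately have "z = \<tau> / 2 * of_int n"
    unfolding assms(2) by (simp add: field_simps)
  then show False
    using assms(3) by blast
qed

theorem theoremB:
  fixes adj :: "'a \<Rightarrow> 'a \<Rightarrow> bool" and q :: nat and v0 :: 'a
    and \<nu> :: "(nat \<Rightarrow> 'a) measure" and \<tau> z :: real
  assumes "2 \<le> q"
    and "homogeneous_tree adj q"
    and "boundary_measure adj q v0 \<nu>"
    and "\<tau> = 2 * pi / ln (real q)"
    and "z \<notin> {\<tau> / 2 * of_int k | k :: int. True}"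
  shows "\<exists>C::real. 0 < C \<and>
    (\<forall>f. finite {x. f x \<noteq> 0} \<longrightarrow>
       helgason_fourier adj q v0 (of_real z) f \<in> L2_space \<nu> \<and>
       ennreal (L2_norm \<nu> (helgason_fourier adj q v0 (of_real z) f))
         \<le> ennreal C * lorentz21_norm f) \<and>
    (\<exists>T. helgason_fourier_extension adj q v0 \<nu> (of_real z) T) \<and>
    (\<forall>T. helgason_fourier_extension adj q v0 \<nu> (of_real z) T \<longrightarrow>
       (\<forall>f \<in> lorentz21. ennreal (L2_norm \<nu> (T f)) \<le> ennreal C * lorentz21_norm f))"
proof -
  interpret tree_boundary adj q v0 \<nu>
    by unfold_locales (rule assms)+
  obtain C where C: "0 < C" "\<And>f. finite {x. f x \<noteq> 0} \<Longrightarrow>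
      helgason_fourier adj q v0 (of_real z) f \<in> L2_space \<nu> \<and>
      ennreal (L2_norm \<nu> (helgason_fourier adj q v0 (of_real z) f)) \<le> ennreal C * lorentz21_norm f"
    using restriction_finite_support[OF cis_ne_1[OF assms(1,4,5)]] by blast
  show ?thesis
  proof (intro exI[of _ C] conjI allI impI ballI)
    show "\<exists>T. helgason_fourier_extension adj q v0 \<nu> (of_real z) T"
      using C(2) by (rule extension_exists)
    show "ennreal (L2_norm \<nu> (T f)) \<le> ennreal C * lorentz21_norm f"
      if "helgason_fourier_extension adj q v0 \<nu> (of_real z) T" "f \<in> lorentz21" for T f
      using C(2) that by (rule extension_bounded)
  qed (use C in auto)
qed

end
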